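(* Let $\epsilon>0$ and let $\rho,\sigma$ be quantum states on a finite-dimensional Hilbert space $H_A$. Then \[ \sup_{\mathcal A\in\mathrm{LDP}_\epsilon} H_{\frac12}(\mathcal A(\rho)\|\mathcal A(\sigma))\le\frac{e^\epsilon-1}{e^\epsilon+1}\,H_{\frac12}(\rho\|\sigma), \] and hence \[ n^{\star}_{\mathrm B,\epsilon}(\rho,\sigma,0.5,0.1)\ge\frac{(e^\epsilon+1)\log 2.5}{2(e^\epsilon-1)H_{\frac12}(\rho\|\sigma)}. \]
   Context: All Hilbert spaces are finite-dimensional, $\log$ is natural, $a/0=+\infty$ for $a>0$. $E_\gamma(\rho\|\sigma)=\mathrm{Tr}(\rho-\gamma\sigma)_+$. $H_{\frac12}(\rho\|\sigma)=\frac12\int_1^\infty\gamma^{-3/2}\big(E_\gamma(\rho\|\sigma)+E_\gamma(\sigma\|\rho)\big)d\gamma$. For $p\in(0,1)$, $p_e(\rho,\sigma,p):=p-pE_{(1-p)/p}(\rho\|\sigma)$ and $n^{\star}_{\mathrm B}(\rho,\sigma,p,\delta):=\inf\{n\in\mathbb N:p_e(\rho^{\otimes n},\sigma^{\otimes n},p)\le\delta\}$. A quantum channel $\mathcal A$ from operators on $H_A$ to operators on some finite-dimensional $H_B$ is in $\mathrm{LDP}_\epsilon$ if $E_{e^\epsilon}(\mathcal A(\rho)\|\mathcal A(\sigma))=0$ for all states $\rho,\sigma$ on $H_A$; $n^{\star}_{\mathrm B,\epsilon}(\rho,\sigma,p,\delta):=\inf_{\mathcal A\in\mathrm{LDP}_\epsilon}n^{\star}_{\mathrm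 B}(\mathcal A(\rho),\mathcal A(\sigma),p,\delta)$ over all such channels with arbitrary finite-dimensional output. *)

theory Defs
  imports "HOL-Analysis.Analysis" "HOL-Library.Extended_Real" "Jordan_Normal_Form.Matrix"
begin

(* Operators on a d-dimensional Hilbert space are d x d complex matrices. *)

definition mtrace :: "complex mat \<Rightarrow> complex" where
  "mtrace A = (\<Sum>i<dim_row A. A $$ (i,i))"

definition adj :: "complex mat \<Rightarrow> complex mat" where
  "adj A = mat (dim_col A) (dim_row A) (\<lambda>(i,j). cnj (A $$ (j,i)))"

definition hermitian_on :: "nat \<Rightarrow> complex mat \<Rightarrow> bool" where
  "hermitian_on n A \<longleftrightarrow> A \<in> carrier_mat n n \<and> adj A = A"

definition psd_on :: "nat \<Rightarrow> complex mat \<Rightarrow> bool" where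
  "psd_on n A \<longleftrightarrow> hermitian_on n A \<and>
     (\<forall>v \<in> carrier_vec n. 0 \<le> Re (\<Sum>i<n. \<Sum>j<n. cnj (vec_index v i) * A $$ (i,j) * vec_index v j))"

definition density :: "nat \<Rightarrow> complex mat \<Rightarrow> bool" where
  "density n \<rho> \<longleftrightarrow> psd_on n \<rho> \<and> mtrace \<rho> = 1"

definition unitary_on :: "nat \<Rightarrow> complex mat \<Rightarrow> bool" where
  "unitary_on n U \<longleftrightarrow> U \<in> carrier_mat n n \<and> U * adj U = 1\<^sub>m n"

definition pos_part :: "complex mat \<Rightarrow> complex mat" where
  "pos_part A = (let n = dim_row A;
      (U, D) = (SOME (U, D). unitary_on n U \<and> D \<in> carrier_mat n n \<and>
                   (\<forall>i<n. \<forall>j<n. i \<noteq> j \<longrightarrow> D $$ (i,j) = 0) \<and>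
                   (\<forall>i<n. D $$ (i,i) \<in> \<real>) \<and> A = U * D * adj U)
     in U * mat n n (\<lambda>(i,j). if i = j then complex_of_real (max (Re (D $$ (i,i))) 0) else 0) * adj U)"

definition E_hs :: "real \<Rightarrow> complex mat \<Rightarrow> complex mat \<Rightarrow> real" where
  "E_hs \<gamma> \<rho> \<sigma> = Re (mtrace (pos_part (\<rho> - complex_of_real \<gamma> \<cdot>\<^sub>m \<sigma>)))"

definition H_half :: "complex mat \<Rightarrow> complex mat \<Rightarrow> real" where
  "H_half \<rho> \<sigma> = 1/2 * integral {1..} (\<lambda>\<gamma>::real. \<gamma> powr (-3/2) * (E_hs \<gamma> \<rho> \<sigma> + E_hs \<gamma> \<sigma> \<rho>))"

definition kron :: "complex mat \<Rightarrow> complex mat \<Rightarrow> complex mat" where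
  "kron A B = mat (dim_row A * dim_row B) (dim_col A * dim_col B)
     (\<lambda>(i,j). A $$ (i div dim_row B, j div dim_col B) * B $$ (i mod dim_row B, j mod dim_col B))"

fun tpow :: "complex mat \<Rightarrow> nat \<Rightarrow> complex mat" where
  "tpow A 0 = 1\<^sub>m 1"
| "tpow A (Suc n) = kron A (tpow A n)"

definition p_err :: "complex mat \<Rightarrow> complex mat \<Rightarrow> real \<Rightarrow> real" where
  "p_err \<rho> \<sigma> p = p - p * E_hs ((1 - p) / p) \<rho> \<sigma>"

text \<open>Sample complexity; infimum of the empty set is +infinity.\<close>
definition nB :: "complex mat \<Rightarrow> complex mat \<Rightarrow> real \<Rightarrow> real \<Rightarrow> ereal" where
  "nB \<rho> \<sigma> p \<delta> = Inf {ereal (real n) | n. n \<ge> 1 \<and> p_err (tpow \<rho> n) (tpow \<sigma> n) p \<le> \<delta>}"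

definition blk :: "nat \<Rightarrow> complex mat \<Rightarrow> nat \<Rightarrow> nat \<Rightarrow> complex mat" where
  "blk d X a b = mat d d (\<lambda>(i,j). X $$ (a * d + i, b * d + j))"

definition id_tensor :: "nat \<Rightarrow> nat \<Rightarrow> nat \<Rightarrow> (complex mat \<Rightarrow> complex mat) \<Rightarrow> complex mat \<Rightarrow> complex mat" where
  "id_tensor k dA dB \<Phi> X = mat (k * dB) (k * dB)
     (\<lambda>(i,j). \<Phi> (blk dA X (i div dB) (j div dB)) $$ (i mod dB, j mod dB))"

definition channel :: "nat \<Rightarrow> nat \<Rightarrow> (complex mat \<Rightarrow> complex mat) \<Rightarrow> bool" where
  "channel dA dB \<Phi> \<longleftrightarrow>
     (\<forall>X \<in> carrier_mat dA dA. \<Phi> X \<in> carrier_mat dB dB) \<and>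
     (\<forall>X \<in> carrier_mat dA dA. \<forall>Y \<in> carrier_mat dA dA. \<Phi> (X + Y) = \<Phi> X + \<Phi> Y) \<and>
     (\<forall>X \<in> carrier_mat dA dA. \<forall>c. \<Phi> (c \<cdot>\<^sub>m X) = c \<cdot>\<^sub>m \<Phi> X) \<and>
     (\<forall>X \<in> carrier_mat dA dA. mtrace (\<Phi> X) = mtrace X) \<and>
     (\<forall>k X. psd_on (k * dA) X \<longrightarrow> psd_on (k * dB) (id_tensor k dA dB \<Phi> X))"

definition LDP :: "real \<Rightarrow> nat \<Rightarrow> nat \<Rightarrow> (complex mat \<Rightarrow> complex mat) \<Rightarrow> bool" where
  "LDP \<epsilon> dA dB \<Phi> \<longleftrightarrow> channel dA dB \<Phi> \<and>
     (\<forall>\<rho> \<sigma>. density dA \<rho> \<longrightarrow> density dA \<sigma> \<longrightarrow> E_hs (exp \<epsilon>) (\<Phi> \<rho>) (\<Phi> \<sigma>) = 0)"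

definition nB_eps :: "real \<Rightarrow> nat \<Rightarrow> complex mat \<Rightarrow> complex mat \<Rightarrow> real \<Rightarrow> real \<Rightarrow> ereal" where
  "nB_eps \<epsilon> dA \<rho> \<sigma> p \<delta> =
     (INF (dB, \<Phi>) \<in> {(dB, \<Phi>). LDP \<epsilon> dA dB \<Phi>}. nB (\<Phi> \<rho>) (\<Phi> \<sigma>) p \<delta>)"

end

theory Submission
  imports Defs "Jordan_Normal_Form.Spectral_Radius"
begin

text \<open>
  Contraction: write \<open>\<rho> - \<gamma>\<sigma> = P - N\<close> with \<open>P, N \<ge> 0\<close>; for \<open>\<gamma> \<ge> 1\<close> one has \<open>Tr P \<le> Tr N\<close>, so
  \<open>E\<^sub>\<gamma>\<close> of the outputs is at most \<open>Tr P\<close> times the trace distance of the images of the two states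
  \<open>P / Tr P\<close> and \<open>N / Tr N\<close>.  If these images satisfy \<open>a \<le> e\<^sup>\<epsilon> b\<close> and \<open>1 - b \<le> e\<^sup>\<epsilon> (1 - a)\<close> on
  every projection, then \<open>a - b \<le> (e\<^sup>\<epsilon> - 1) / (e\<^sup>\<epsilon> + 1)\<close>.

  Sample complexity: data processing under the Fuchs-Caves measurement gives a pair of
  purifications with overlap at least \<open>1 - H/2\<close>.  Overlaps of purifications are multiplicative under
  tensor powers and bound the trace distance, so an error of at most \<open>1/10\<close> with \<open>n\<close> copies forces
  \<open>(1 - H/2)\<^sup>2\<^sup>n \<le> 1 - (4/5)\<^sup>2 \<le> 2/5\<close>, and \<open>ln (1 - H/2) \<ge> -H\<close> when \<open>H \<le> 1\<close>; for \<open>H > 1\<close> the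
  claimed bound is below \<open>1\<close>.  The Fuchs-Caves measurement needs invertible states, which is arranged
  by depolarizing both: for \<open>\<gamma> \<ge> 1\<close> this does not increase \<open>E\<^sub>\<gamma>\<close>, and the limit is only taken in the
  entries of the tensor powers.
\<close>

subsection \<open>Spectral decomposition\<close>

lemma dim_adj [simp]: "dim_row (adj A) = dim_col A" "dim_col (adj A) = dim_row A"
  by (auto simp: adj_def)

lemma adj_carrier [simp, intro]: "A \<in> carrier_mat n m \<Longrightarrow> adj A \<in> carrier_mat m n"
  by (auto simp: adj_def)

lemma index_adj [simp]: "i < dim_col A \<Longrightarrow> j < dim_row A \<Longrightarrow> adj A $$ (i,j) = cnj (A $$ (j,i))"
  by (simp add: adj_def)

lemma adj_adj [simp]: "adj (adj A) = A"
  by (rule eq_matI) auto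

lemma adj_one [simp]: "adj (1\<^sub>m n) = 1\<^sub>m n"
  by (rule eq_matI) auto

lemma index_mult_sum:
  "A \<in> carrier_mat n m \<Longrightarrow> B \<in> carrier_mat m k \<Longrightarrow> i < n \<Longrightarrow> j < k \<Longrightarrow>
    (A * B) $$ (i,j) = (\<Sum>l<m. A $$ (i,l) * B $$ (l,j))"
  by (simp add: scalar_prod_def atLeast0LessThan)

lemma mult_carrier_square [simp]:
  "A \<in> carrier_mat n n \<Longrightarrow> B \<in> carrier_mat n n \<Longrightarrow> A * B \<in> carrier_mat n n"
  by (rule mult_carrier_mat)

lemma adj_mult:
  assumes "A \<in> carrier_mat n m" "B \<in> carrier_mat m k"
  shows "adj (A * B) = adj B * adj A"
proof (rule eq_matI)
  fix i j assume "i < dim_row (adj B * adj A)" "j < dim_col (adj B * adj A)"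
  then have ij: "i < k" "j < n" using assms by auto
  have "adj (A * B) $$ (i,j) = cnj ((A * B) $$ (j,i))" using assms ij by simp
  also have "\<dots> = (\<Sum>l<m. cnj (A $$ (j,l)) * cnj (B $$ (l,i)))"
    by (subst index_mult_sum[OF assms]) (use ij in auto)
  also have "\<dots> = (\<Sum>l<m. adj B $$ (i,l) * adj A $$ (l,j))"
    by (rule sum.cong) (use assms ij in auto)
  also have "\<dots> = (adj B * adj A) $$ (i,j)"
    by (subst index_mult_sum[of _ k m _ n]) (use assms ij in auto)
  finally show "adj (A * B) $$ (i,j) = (adj B * adj A) $$ (i,j)" .
qed (use assms in auto)

lemma mtrace_carrier: "A \<in> carrier_mat n n \<Longrightarrow> mtrace A = (\<Sum>i<n. A $$ (i,i))"
  by (auto simp: mtrace_def)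

lemma mtrace_comm:
  assumes "A \<in> carrier_mat n m" "B \<in> carrier_mat m n"
  shows "mtrace (A * B) = mtrace (B * A)"
proof -
  have "mtrace (A * B) = (\<Sum>i<n. \<Sum>l<m. A $$ (i,l) * B $$ (l,i))"
    by (subst mtrace_carrier[of _ n]) (use assms in \<open>auto intro!: sum.cong index_mult_sum simp del: index_mult_mat\<close>)
  also have "\<dots> = (\<Sum>l<m. \<Sum>i<n. B $$ (l,i) * A $$ (i,l))"
    by (subst sum.swap) (simp add: mult.commute)
  also have "\<dots> = mtrace (B * A)"
    by (subst mtrace_carrier[of _ m]) (use assms in \<open>auto intro!: sum.cong index_mult_sum[symmetric] simp del: index_mult_mat\<close>)
  finally show ?thesis .
qed

text \<open>For square matrices a right inverse is also a left inverse, so the one-sided definition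
  of \<open>unitary_on\<close> yields both identities.\<close>

lemma unitary_onD:
  assumes "unitary_on n U"
  shows "U \<in> carrier_mat n n" "U * adj U = 1\<^sub>m n" "adj U * U = 1\<^sub>m n"
  using assms mat_mult_left_right_inverse[of U n "adj U"] by (auto simp: unitary_on_def)

lemma unitary_on_mult:
  assumes U: "unitary_on n U" and V: "unitary_on n V"
  shows "unitary_on n (U * V)"
proof -
  note c = unitary_onD(1)[OF U] unitary_onD(1)[OF V]
  have "(U * V) * adj (U * V) = U * (V * adj V) * adj U"
    using c by (simp add: adj_mult[OF c] assoc_mult_mat[of _ n n _ n _ n])
  then show ?thesis
    using c unitary_onD(2)[OF U] unitary_onD(2)[OF V] by (simp add: unitary_on_def)
qed

lemma unitary_on_adj: "unitary_on n U \<Longrightarrow> unitary_on n (adj U)"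
  by (frule unitary_onD(1), drule unitary_onD(3)) (simp add: unitary_on_def)

section \<open>Diagonalization of Hermitian matrices\<close>

definition diag_real :: "nat \<Rightarrow> (nat \<Rightarrow> real) \<Rightarrow> complex mat" where
  "diag_real n f = mat n n (\<lambda>(i,j). if i = j then complex_of_real (f i) else 0)"

lemma diag_real_carrier [simp, intro]: "diag_real n f \<in> carrier_mat n n"
  by (simp add: diag_real_def)

lemma index_diag_real [simp]:
  "i < n \<Longrightarrow> j < n \<Longrightarrow> diag_real n f $$ (i,j) = (if i = j then complex_of_real (f i) else 0)"
  by (simp add: diag_real_def)

lemma dim_diag_real [simp]: "dim_row (diag_real n f) = n" "dim_col (diag_real n f) = n"
  by (simp_all add: diag_real_def)

text \<open>Completes a unit vector to a unitary by the reflection along \<open>w = v - e_0\<close>.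
  Because \<open>v 0\<close> is the real number \<open>r\<close>, the squared norm of
  \<open>w\<close> is \<open>2 * (1 - r)\<close>, so the reflection with
  \<open>c = 1 / (1 - r)\<close> is unitary and sends \<open>e_0\<close> to \<open>v\<close>. If
  \<open>r = 1\<close>, then \<open>v = e_0\<close> and the identity serves.\<close>

lemma householder:
  fixes v :: "nat \<Rightarrow> complex"
  assumes n: "n > 0" and norm1: "(\<Sum>i<n. (cmod (v i))\<^sup>2) = 1" and v0: "v 0 = complex_of_real r"
  shows "\<exists>W. unitary_on n W \<and> (\<forall>i<n. W $$ (i,0) = v i)"
proof (cases "r = 1")
  case True
  have "(\<Sum>i<n. (cmod (v i))\<^sup>2) = (cmod (v 0))\<^sup>2 + (\<Sum>i\<in>{..<n}-{0}. (cmod (v i))\<^sup>2)"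
    using n by (subst sum.remove[of _ 0]) auto
  then have "(\<Sum>i\<in>{..<n}-{0}. (cmod (v i))\<^sup>2) = 0" using norm1 v0 True by simp
  then have z: "v i = 0" if "i < n" "i \<noteq> 0" for i
    using that by (subst (asm) sum_nonneg_eq_0_iff) auto
  show ?thesis
  proof (intro exI conjI allI impI)
    show "unitary_on n (1\<^sub>m n)" by (simp add: unitary_on_def)
    show "1\<^sub>m n $$ (i,0) = v i" if "i < n" for i
      using that z[of i] v0 True n by (cases "i = 0") auto
  qed
next
  case False
  define w where "w i = v i - (if i = 0 then 1 else 0)" for i
  define c where "c = complex_of_real (1 / (1 - r))"
  have c1: "c * (1 - of_real r) = 1" 
  proof -
    have "c * (1 - of_real r) = complex_of_real (1 / (1 - r) * (1 - r))"
      unfolding c_def of_real_mult by simp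
    then show ?thesis using False by simp
  qed
  have cc: "cnj c = c" by (simp add: c_def)
  have "(\<Sum>i<n. cnj (w i) * w i) = cnj (w 0) * w 0 + (\<Sum>i\<in>{..<n}-{0}. cnj (v i) * v i)"
    using n by (subst sum.remove[of _ 0]) (auto simp: w_def)
  moreover have "(\<Sum>i<n. cnj (v i) * v i) = cnj (v 0) * v 0 + (\<Sum>i\<in>{..<n}-{0}. cnj (v i) * v i)"
    using n by (subst sum.remove[of _ 0]) auto
  moreover have "(\<Sum>i<n. cnj (v i) * v i) = complex_of_real (\<Sum>i<n. (cmod (v i))\<^sup>2)"
    by (simp only: of_real_sum complex_norm_square) (simp add: mult.commute)
  ultimately have ww: "(\<Sum>i<n. cnj (w i) * w i) = 2 * (1 - of_real r)"
    using norm1 v0 by (simp add: w_def algebra_simps)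
  define W where "W = mat n n (\<lambda>(i,j). (if i = j then 1 else 0) - c * w i * cnj (w j))"
  have Wc: "W \<in> carrier_mat n n" by (simp add: W_def)
  have "W * adj W = 1\<^sub>m n"
  proof (rule eq_matI)
    fix i j assume "i < dim_row (1\<^sub>m n :: complex mat)" "j < dim_col (1\<^sub>m n :: complex mat)"
    then have ij: "i < n" "j < n" by auto
    have "(W * adj W) $$ (i,j) = (\<Sum>l<n. W $$ (i,l) * adj W $$ (l,j))"
      by (rule index_mult_sum) (use Wc ij in auto)
    also have "\<dots> = (\<Sum>l<n. (if i = l then (if j = l then 1 else 0) - c * w l * cnj (w j) else 0)
        - (if j = l then c * w i * cnj (w l) else 0) + c * c * w i * cnj (w j) * (cnj (w l) * w l))"
      using ij by (intro sum.cong refl) (auto simp: W_def cc algebra_simps)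
    also have "\<dots> = (if j = i then 1 else 0) - c * w i * cnj (w j) - c * w i * cnj (w j)
        + c * c * w i * cnj (w j) * (\<Sum>l<n. cnj (w l) * w l)"
      using ij by (simp add: sum.distrib sum_subtractf sum_distrib_left)
    \<comment> \<open>By \<open>ww\<close> the quadratic term is twice
      \<open>c * w i * cnj (w j)\<close> up to the factor \<open>c * (1 - r) = 1\<close>, so it
      cancels the two linear terms.\<close>
    also have "c * c * w i * cnj (w j) * (\<Sum>l<n. cnj (w l) * w l)
        = 2 * (c * (1 - of_real r)) * (c * w i * cnj (w j))" by (simp add: ww)
    finally show "(W * adj W) $$ (i,j) = 1\<^sub>m n $$ (i,j)" using ij by (auto simp: c1)
  qed (simp_all add: W_def)
  moreover have "W $$ (i,0) = v i" if "i < n" for i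
  proof -
    have "W $$ (i,0) = (if i = 0 then 1 else 0) + (c * (1 - of_real r)) * w i"
      using that n by (simp add: W_def w_def v0 algebra_simps)
    then show ?thesis by (simp add: c1 w_def)
  qed
  ultimately show ?thesis using Wc by (auto simp: unitary_on_def)
qed

text \<open>A complex matrix of positive size has an eigenvalue. The eigenvector is normalized and
  multiplied by a phase that makes its first coordinate real, as \<open>householder\<close>
  requires.\<close>

lemma exists_unit_eigenvector:
  assumes A: "A \<in> carrier_mat n n" and n: "n > 0"
  shows "\<exists>l v r. (\<Sum>i<n. (cmod (v i))\<^sup>2) = 1 \<and> v 0 = complex_of_real r \<and>
           (\<forall>i<n. (\<Sum>j<n. A $$ (i,j) * v j) = l * v i)"
proof -
  obtain l u where "eigenvector A u l"
    using spectrum_non_empty[OF A n] by (auto simp: spectrum_def eigenvalue_def)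
  then have u: "u \<in> carrier_vec n" "u \<noteq> 0\<^sub>v n" "A *\<^sub>v u = l \<cdot>\<^sub>v u"
    using A by (auto simp: eigenvector_def)
  have Au: "(\<Sum>j<n. A $$ (i,j) * vec_index u j) = l * vec_index u i" if "i < n" for i
  proof -
    have "vec_index (A *\<^sub>v u) i = (\<Sum>j<n. A $$ (i,j) * vec_index u j)"
      using that A u(1) by (simp add: scalar_prod_def atLeast0LessThan)
    then show ?thesis using u that by simp
  qed
  define s where "s = (\<Sum>i<n. (cmod (vec_index u i))\<^sup>2)"
  have "\<exists>i<n. vec_index u i \<noteq> 0"
  proof (rule ccontr)
    assume "\<not> ?thesis"
    then have "u = 0\<^sub>v n" using u(1) by (intro eq_vecI) auto
    with u(2) show False by simp
  qed
  then have s0: "s > 0"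
    unfolding s_def by (auto intro!: sum_pos2)
  \<comment> \<open>A vanishing first coordinate is already real, so the phase defaults to
    1.\<close>
  define ph where "ph = (if vec_index u 0 = 0 then 1 else cnj (vec_index u 0) / cmod (vec_index u 0))"
  have ph: "cmod ph = 1" by (simp add: ph_def norm_divide)
  define v where "v i = ph / sqrt s * vec_index u i" for i
  have "(\<Sum>i<n. (cmod (v i))\<^sup>2) = (\<Sum>i<n. (cmod (vec_index u i))\<^sup>2) / s"
    using s0 by (simp add: v_def norm_mult norm_divide ph power_divide power_mult_distrib sum_divide_distrib)
  moreover have "v 0 = complex_of_real (cmod (vec_index u 0) / sqrt s)"
  proof (cases "vec_index u 0 = 0")
    case False
    have "cnj (vec_index u 0) * vec_index u 0 = complex_of_real (cmod (vec_index u 0)) * cmod (vec_index u 0)"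
      by (metis complex_norm_square mult.commute of_real_power power2_eq_square)
    then show ?thesis using False by (simp add: v_def ph_def)
  qed (simp add: v_def)
  moreover have "(\<Sum>j<n. A $$ (i,j) * v j) = l * v i" if "i < n" for i
  proof -
    have "(\<Sum>j<n. A $$ (i,j) * v j) = ph / sqrt s * (\<Sum>j<n. A $$ (i,j) * vec_index u j)"
      by (simp add: v_def sum_distrib_left algebra_simps)
    then show ?thesis by (simp add: Au[OF that] v_def)
  qed
  moreover have "(\<Sum>i<n. (cmod (vec_index u i))\<^sup>2) / s = 1" using s0 by (simp flip: s_def)
  ultimately have "(\<Sum>i<n. (cmod (v i))\<^sup>2) = 1 \<and> v 0 = complex_of_real (cmod (vec_index u 0) / sqrt s) \<and>
      (\<forall>i<n. (\<Sum>j<n. A $$ (i,j) * v j) = l * v i)" by simp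
  then show ?thesis by blast
qed

lemma hermitian_onD:
  assumes "hermitian_on n A"
  shows "A \<in> carrier_mat n n" "adj A = A" "\<And>i j. i < n \<Longrightarrow> j < n \<Longrightarrow> cnj (A $$ (i,j)) = A $$ (j,i)"
proof -
  show c: "A \<in> carrier_mat n n" "adj A = A" using assms by (auto simp: hermitian_on_def)
  show "cnj (A $$ (i,j)) = A $$ (j,i)" if "i < n" "j < n" for i j
    using index_adj[of j A i] c that by auto
qed

text \<open>Induction by deflation: conjugation with a unitary whose first column is an eigenvector
  splits off a 1 by 1 block, and the induction hypothesis diagonalizes the remaining Hermitian
  block.\<close>

theorem spectral_decomposition:
  "hermitian_on n A \<Longrightarrow> \<exists>U f. unitary_on n U \<and> A = U * diag_real n f * adj U"
proof (induction n arbitrary: A)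
  case 0
  then have "A = 1\<^sub>m 0 * diag_real 0 (\<lambda>_. 0) * adj (1\<^sub>m 0)"
    using hermitian_onD(1)[OF 0] by (intro eq_matI) auto
  moreover have "unitary_on 0 (1\<^sub>m 0)" by (simp add: unitary_on_def)
  ultimately show ?case by blast
next
  case (Suc m)
  let ?n = "Suc m"
  note A = hermitian_onD[OF Suc.prems]
  obtain l v r where v: "(\<Sum>i<?n. (cmod (v i))\<^sup>2) = 1" "v 0 = complex_of_real r"
      "\<And>i. i < ?n \<Longrightarrow> (\<Sum>j<?n. A $$ (i,j) * v j) = l * v i"
    using exists_unit_eigenvector[OF A(1)] by blast
  obtain W where W: "unitary_on ?n W" "\<And>i. i < ?n \<Longrightarrow> W $$ (i,0) = v i"
    using householder[OF _ v(1,2)] by auto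
  note Wc = unitary_onD[OF W(1)]
  define B where "B = adj W * A * W"
  have Bc: "B \<in> carrier_mat ?n ?n" using Wc A by (auto simp: B_def)
  have "adj B = B"
    unfolding B_def using A(1) Wc(1)
    by (simp add: adj_mult[of _ ?n ?n _ ?n] A(2) assoc_mult_mat[of _ ?n ?n _ ?n _ ?n])
  then have B: "hermitian_on ?n B" using Bc by (simp add: hermitian_on_def)
  have AW0: "(A * W) $$ (i,0) = l * W $$ (i,0)" if "i < ?n" for i
  proof -
    have "(A * W) $$ (i,0) = (\<Sum>j<?n. A $$ (i,j) * W $$ (j,0))"
      by (rule index_mult_sum) (use A Wc that in auto)
    also have "\<dots> = (\<Sum>j<?n. A $$ (i,j) * v j)" by (rule sum.cong) (simp_all add: W(2))
    finally show ?thesis using v(3)[OF that] W(2)[OF that] by simp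
  qed
  have Bi0: "B $$ (i,0) = (if i = 0 then l else 0)" if "i < ?n" for i
  proof -
    have "B $$ (i,0) = (adj W * (A * W)) $$ (i,0)"
      unfolding B_def using A Wc by (simp add: assoc_mult_mat[of _ ?n ?n _ ?n _ ?n])
    also have "\<dots> = (\<Sum>j<?n. adj W $$ (i,j) * (A * W) $$ (j,0))"
      by (rule index_mult_sum) (use A Wc that in auto)
    also have "\<dots> = (\<Sum>j<?n. l * (adj W $$ (i,j) * W $$ (j,0)))"
      by (rule sum.cong) (simp_all only: AW0 lessThan_iff mult.left_commute mult.commute)
    also have "\<dots> = l * (adj W * W) $$ (i,0)"
      by (subst index_mult_sum[of _ ?n ?n _ ?n]) (use A Wc that in \<open>auto simp: sum_distrib_left simp del: sum.lessThan_Suc\<close>)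
    finally show ?thesis using that Wc(3) by simp
  qed
  \<comment> \<open>The first column vanishes below the corner because it comes from an eigenvector;
    Hermitian symmetry carries this over to the first row and makes \<open>l\<close> real.\<close>
  have B0i: "B $$ (0,i) = (if i = 0 then l else 0)" if "i < ?n" for i
    using hermitian_onD(3)[OF B, of i 0] hermitian_onD(3)[OF B, of 0 0] Bi0[of i] Bi0[of 0] that by auto
  have l: "cnj l = l" using hermitian_onD(3)[OF B, of 0 0] Bi0[of 0] by simp
  define C where "C = mat m m (\<lambda>(i,j). B $$ (Suc i, Suc j))"
  have "hermitian_on m C"
    unfolding hermitian_on_def
  proof
    show "adj C = C"
      by (rule eq_matI) (auto simp: C_def hermitian_onD(3)[OF B])
  qed (simp add: C_def)
  then obtain U f where U: "unitary_on m U" "C = U * diag_real m f * adj U"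
    using Suc.IH by blast
  note Uc = unitary_onD[OF U(1)]
  \<comment> \<open>The unitary of the smaller block is extended by 1 in the corner, and
    \<open>g\<close> puts the split-off eigenvalue in front of the others.\<close>
  define V where "V = four_block_mat (1\<^sub>m 1) (0\<^sub>m 1 m) (0\<^sub>m m 1) U"
  define g where "g = case_nat (Re l) f"
  have Vc: "V \<in> carrier_mat ?n ?n"
    unfolding V_def using four_block_carrier_mat[of "1\<^sub>m 1" 1 1 U m m] Uc by simp
  have adjV: "adj V = four_block_mat (1\<^sub>m 1) (0\<^sub>m 1 m) (0\<^sub>m m 1) (adj U)"
    unfolding V_def using Uc by (intro eq_matI) auto
  have D: "diag_real ?n g = four_block_mat (diag_real 1 (\<lambda>_. Re l)) (0\<^sub>m 1 m) (0\<^sub>m m 1) (diag_real m f)"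
    by (rule eq_matI) (auto simp: g_def split: nat.splits)
  have Vu: "unitary_on ?n V"
    unfolding unitary_on_def
  proof
    show "V * adj V = 1\<^sub>m ?n"
      unfolding adjV unfolding V_def
      by (subst mult_four_block_mat[of _ 1 1 _ m _ m]) (use Uc in auto)
  qed (rule Vc)
  have "V * diag_real ?n g * adj V
      = four_block_mat (diag_real 1 (\<lambda>_. Re l)) (0\<^sub>m 1 m) (0\<^sub>m m 1) C"
    unfolding adjV D unfolding V_def
    by (subst mult_four_block_mat[of _ 1 1 _ m _ m], (use Uc in auto)[8])
       (subst mult_four_block_mat[of _ 1 1 _ m _ m], use Uc in \<open>auto simp: U(2)\<close>)
  also have "\<dots> = B"
    using Bc Bi0 B0i l by (intro eq_matI) (auto simp: C_def complex_eq_iff)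
  finally have VB: "V * diag_real ?n g * adj V = B" .
  have "A = (W * adj W) * A * (W * adj W)" using A Wc by simp
  also have "\<dots> = W * B * adj W"
    unfolding B_def using A(1) Wc(1) by (simp add: assoc_mult_mat[of _ ?n ?n _ ?n _ ?n])
  also have "\<dots> = (W * V) * diag_real ?n g * adj (W * V)"
    unfolding VB[symmetric] using Wc(1) Vc
    by (simp add: adj_mult[of _ ?n ?n _ ?n] assoc_mult_mat[of _ ?n ?n _ ?n _ ?n])
  finally show ?case using unitary_on_mult[OF W(1) Vu] by blast
qed

subsection \<open>The trace of the positive part\<close>

lemma index_diag_mult:
  assumes "B \<in> carrier_mat n m" "i < n" "j < m"
  shows "(diag_real n f * B) $$ (i,j) = complex_of_real (f i) * B $$ (i,j)"
proof -
  have "(diag_real n f * B) $$ (i,j) = (\<Sum>l<n. diag_real n f $$ (i,l) * B $$ (l,j))"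
    by (rule index_mult_sum) (use assms in auto)
  also have "\<dots> = (\<Sum>l<n. if i = l then complex_of_real (f i) * B $$ (l,j) else 0)"
    by (rule sum.cong) (use assms in auto)
  finally show ?thesis using assms by simp
qed

lemma index_congruence_diag:
  assumes V: "V \<in> carrier_mat n m" and ij: "i < m" "j < m"
  shows "(adj V * diag_real n f * V) $$ (i,j) =
    (\<Sum>k<n. complex_of_real (f k) * (cnj (V $$ (k,i)) * V $$ (k,j)))"
proof -
  have "adj V * diag_real n f * V = adj V * (diag_real n f * V)"
    using V by (simp add: assoc_mult_mat[of _ m n _ n _ m])
  then have "(adj V * diag_real n f * V) $$ (i,j) = (\<Sum>k<n. adj V $$ (i,k) * (diag_real n f * V) $$ (k,j))"
    by (simp only:) (rule index_mult_sum, use V ij in auto)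
  also have "\<dots> = (\<Sum>k<n. complex_of_real (f k) * (cnj (V $$ (k,i)) * V $$ (k,j)))"
    by (rule sum.cong) (use V ij in \<open>auto simp: index_diag_mult[OF V] simp del: index_mult_mat\<close>)
  finally show ?thesis .
qed

lemma adj_diag_real [simp]: "adj (diag_real n f) = diag_real n f"
  by (rule eq_matI) auto

lemma diag_real_mult: "diag_real n f * diag_real n g = diag_real n (\<lambda>i. f i * g i)"
  by (rule eq_matI) (auto simp: index_diag_mult[of _ n n] simp del: index_mult_mat(1))

lemma mtrace_diag_real: "mtrace (diag_real n f) = complex_of_real (\<Sum>i<n. f i)"
  by (simp add: mtrace_def)

lemma mtrace_conj_unitary:
  assumes "unitary_on n U" "A \<in> carrier_mat n n"
  shows "mtrace (U * A * adj U) = mtrace A"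
proof -
  note c = unitary_onD[OF assms(1)]
  have "mtrace (U * A * adj U) = mtrace (adj U * (U * A))"
    by (rule mtrace_comm) (use c assms in auto)
  also have "adj U * (U * A) = adj U * U * A"
    using c(1) assms(2) by (simp add: assoc_mult_mat[of _ n n _ n _ n])
  finally show ?thesis using c assms by simp
qed

lemma row_norm_unitary:
  assumes "unitary_on n V" "k < n"
  shows "(\<Sum>i<n. (cmod (V $$ (k,i)))\<^sup>2) = 1"
proof -
  note V = unitary_onD[OF assms(1)]
  have "complex_of_real (\<Sum>i<n. (cmod (V $$ (k,i)))\<^sup>2) = (\<Sum>i<n. V $$ (k,i) * adj V $$ (i,k))"
    unfolding of_real_sum by (rule sum.cong) (use V(1) assms in \<open>auto simp flip: complex_norm_square\<close>)
  also have "\<dots> = (V * adj V) $$ (k,k)"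
    by (subst index_mult_sum[of _ n n _ n]) (use V(1) assms in auto)
  also have "\<dots> = 1" using V assms by simp
  finally show ?thesis by (metis of_real_eq_1_iff)
qed

section \<open>Traces against projections\<close>

text \<open>For unitary \<open>U\<close> this is the trace of \<open>A\<close> against the
  projection onto the columns of \<open>U\<close> indexed by \<open>S\<close>, and every orthogonal
  projection arises in this way. Measurement probabilities are written in this form throughout,
  without projection matrices.\<close>

definition frame_sum :: "nat \<Rightarrow> complex mat \<Rightarrow> nat set \<Rightarrow> complex mat \<Rightarrow> real" where
  "frame_sum n U S A = (\<Sum>i\<in>S. Re (\<Sum>k<n. \<Sum>l<n. cnj (U $$ (k,i)) * A $$ (k,l) * U $$ (l,i)))"

lemma index_congruence:
  assumes "U \<in> carrier_mat n n" "A \<in> carrier_mat n n" "i < n"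
  shows "(adj U * A * U) $$ (i,i) = (\<Sum>k<n. \<Sum>l<n. cnj (U $$ (k,i)) * A $$ (k,l) * U $$ (l,i))"
proof -
  have "(adj U * A * U) $$ (i,i) = (\<Sum>l<n. (adj U * A) $$ (i,l) * U $$ (l,i))"
    by (rule index_mult_sum) (use assms in auto)
  also have "\<dots> = (\<Sum>l<n. \<Sum>k<n. cnj (U $$ (k,i)) * A $$ (k,l) * U $$ (l,i))"
  proof (rule sum.cong[OF refl])
    fix l assume "l \<in> {..<n}"
    then have "(adj U * A) $$ (i,l) = (\<Sum>k<n. adj U $$ (i,k) * A $$ (k,l))"
      by (intro index_mult_sum[of _ n n _ n]) (use assms in auto)
    then show "(adj U * A) $$ (i,l) * U $$ (l,i) = (\<Sum>k<n. cnj (U $$ (k,i)) * A $$ (k,l) * U $$ (l,i))"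
      using assms by (simp add: sum_distrib_right)
  qed
  finally show ?thesis by (subst sum.swap)
qed

lemma frame_sum_eq:
  assumes "U \<in> carrier_mat n n" "A \<in> carrier_mat n n" "S \<subseteq> {..<n}"
  shows "frame_sum n U S A = (\<Sum>i\<in>S. Re ((adj U * A * U) $$ (i,i)))"
  unfolding frame_sum_def
  by (rule sum.cong[OF refl], subst index_congruence) (use assms in auto)

lemma frame_sum_minus:
  assumes "A \<in> carrier_mat n n" "B \<in> carrier_mat n n"
  shows "frame_sum n U S (A - B) = frame_sum n U S A - frame_sum n U S B"
  using assms unfolding frame_sum_def
  by (simp add: algebra_simps sum_subtractf)

lemma frame_sum_smult:
  assumes "A \<in> carrier_mat n n"
  shows "frame_sum n U S (complex_of_real c \<cdot>\<^sub>m A) = c * frame_sum n U S A"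
proof -
  have "(\<Sum>k<n. \<Sum>l<n. cnj (U $$ (k,i)) * (complex_of_real c \<cdot>\<^sub>m A) $$ (k,l) * U $$ (l,i))
      = complex_of_real c * (\<Sum>k<n. \<Sum>l<n. cnj (U $$ (k,i)) * A $$ (k,l) * U $$ (l,i))" for i
    using assms by (simp add: sum_distrib_left algebra_simps)
  then show ?thesis unfolding frame_sum_def by (simp add: sum_distrib_left)
qed

lemma frame_sum_nonneg:
  assumes "psd_on n A"
  shows "0 \<le> frame_sum n U S A"
  unfolding frame_sum_def
proof (rule sum_nonneg)
  fix i
  show "0 \<le> Re (\<Sum>k<n. \<Sum>l<n. cnj (U $$ (k,i)) * A $$ (k,l) * U $$ (l,i))"
    using bspec[OF conjunct2[OF assms[unfolded psd_on_def]], of "vec n (\<lambda>k. U $$ (k,i))"] by simp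
qed

lemma frame_sum_full:
  assumes "unitary_on n U" "A \<in> carrier_mat n n"
  shows "frame_sum n U {..<n} A = Re (mtrace A)"
proof -
  note c = unitary_onD(1)[OF assms(1)]
  have "frame_sum n U {..<n} A = Re (mtrace (adj U * A * U))"
    using c assms(2) by (subst mtrace_carrier[of _ n]) (auto simp: frame_sum_eq)
  then show ?thesis
    using mtrace_conj_unitary[OF unitary_on_adj[OF assms(1)] assms(2)] by simp
qed

lemma frame_sum_compl:
  assumes "unitary_on n U" "A \<in> carrier_mat n n" "S \<subseteq> {..<n}"
  shows "frame_sum n U ({..<n} - S) A = Re (mtrace A) - frame_sum n U S A"
  unfolding frame_sum_full[OF assms(1,2), symmetric]
  using assms(3) by (simp add: frame_sum_def sum_diff)

lemma frame_sum_spectral: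
  assumes W: "unitary_on n W" and U: "unitary_on n U" and S: "S \<subseteq> {..<n}"
  shows "frame_sum n U S (W * diag_real n f * adj W) =
    (\<Sum>i\<in>S. \<Sum>k<n. f k * (cmod ((adj W * U) $$ (k,i)))\<^sup>2)"
proof -
  note c = unitary_onD(1)[OF W] unitary_onD(1)[OF U]
  let ?V = "adj W * U"
  have V: "?V \<in> carrier_mat n n" using c by simp
  have e: "adj U * (W * diag_real n f * adj W) * U = adj ?V * diag_real n f * ?V"
    using c by (simp add: adj_mult[of _ n n _ n] assoc_mult_mat[of _ n n _ n _ n])
  have "(adj U * (W * diag_real n f * adj W) * U) $$ (i,i)
      = complex_of_real (\<Sum>k<n. f k * (cmod (?V $$ (k,i)))\<^sup>2)" if "i \<in> S" for i
    unfolding e index_congruence_diag[OF V subsetD[OF S that, simplified] subsetD[OF S that, simplified]]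
    by (simp only: of_real_sum of_real_mult complex_norm_square) (simp add: mult.commute)
  then show ?thesis using c S by (subst frame_sum_eq) auto
qed

text \<open>The squared moduli in each row of the unitary \<open>adj W * U\<close> sum to 1, so a
  projection collects each eigenvalue \<open>f k\<close> with a weight between 0 and 1. The best
  conceivable outcome is to collect exactly the positive eigenvalues.\<close>

lemma frame_sum_spectral_le:
  assumes W: "unitary_on n W" and U: "unitary_on n U" and S: "S \<subseteq> {..<n}"
  shows "frame_sum n U S (W * diag_real n f * adj W) \<le> (\<Sum>k<n. max (f k) 0)"
proof -
  let ?V = "adj W * U"
  have V: "unitary_on n ?V" by (rule unitary_on_mult[OF unitary_on_adj[OF W] U])
  have "frame_sum n U S (W * diag_real n f * adj W)
      = (\<Sum>i\<in>S. \<Sum>k<n. f k * (cmod (?V $$ (k,i)))\<^sup>2)"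
    by (rule frame_sum_spectral[OF assms])
  also have "\<dots> \<le> (\<Sum>i\<in>S. \<Sum>k<n. max (f k) 0 * (cmod (?V $$ (k,i)))\<^sup>2)"
    by (intro sum_mono mult_right_mono) auto
  also have "\<dots> \<le> (\<Sum>i<n. \<Sum>k<n. max (f k) 0 * (cmod (?V $$ (k,i)))\<^sup>2)"
    by (rule sum_mono2[OF _ S]) (auto intro!: sum_nonneg)
  also have "\<dots> = (\<Sum>k<n. max (f k) 0 * (\<Sum>i<n. (cmod (?V $$ (k,i)))\<^sup>2))"
    by (subst sum.swap) (simp add: sum_distrib_left)
  also have "\<dots> = (\<Sum>k<n. max (f k) 0)"
    by (rule sum.cong) (simp_all add: row_norm_unitary[OF V] del: index_mult_mat)
  finally show ?thesis .
qed

section \<open>The positive part and its variational formula\<close>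

text \<open>\<open>pos_part\<close> selects a diagonalization by \<open>SOME\<close>. One exists by
  \<open>spectral_decomposition\<close>, so the selected pair is a genuine diagonalization;
  \<open>P\<close> repeats the predicate of the definition.\<close>

lemma pos_part_spectral:
  assumes "hermitian_on n A"
  shows "\<exists>U f. unitary_on n U \<and> A = U * diag_real n f * adj U \<and>
           pos_part A = U * diag_real n (\<lambda>i. max (f i) 0) * adj U"
proof -
  define P where "P = (\<lambda>(U, D). unitary_on n U \<and> D \<in> carrier_mat n n \<and>
                   (\<forall>i<n. \<forall>j<n. i \<noteq> j \<longrightarrow> D $$ (i,j) = 0) \<and>
                   (\<forall>i<n. D $$ (i,i) \<in> \<real>) \<and> A = U * D * adj U)"
  have dim: "dim_row A = n" using hermitian_onD(1)[OF assms] by auto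
  obtain U0 f0 where "unitary_on n U0" "A = U0 * diag_real n f0 * adj U0"
    using spectral_decomposition[OF assms] by blast
  then have "P (U0, diag_real n f0)" by (auto simp: P_def)
  then have PS: "P (Eps P)" by (rule someI)
  obtain U D where UD: "Eps P = (U, D)" by force
  have U: "unitary_on n U" and Dc: "D \<in> carrier_mat n n" and A: "A = U * D * adj U"
    and off: "\<And>i j. i < n \<Longrightarrow> j < n \<Longrightarrow> i \<noteq> j \<Longrightarrow> D $$ (i,j) = 0"
    and re: "\<And>i. i < n \<Longrightarrow> D $$ (i,i) \<in> \<real>"
    using PS unfolding UD unfolding P_def by auto
  define f where "f i = Re (D $$ (i,i))" for i
  have "D = diag_real n f"
    using Dc off re by (intro eq_matI) (auto simp: f_def)
  moreover have "pos_part A = U * diag_real n (\<lambda>i. max (f i) 0) * adj U"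
    using UD unfolding pos_part_def dim Let_def P_def diag_real_def f_def by simp
  ultimately show ?thesis using U A by blast
qed

definition tr_pos :: "complex mat \<Rightarrow> real" where
  "tr_pos A = Re (mtrace (pos_part A))"

lemma tr_pos_spectral:
  assumes "hermitian_on n A"
  shows "\<exists>U f. unitary_on n U \<and> A = U * diag_real n f * adj U \<and> tr_pos A = (\<Sum>i<n. max (f i) 0)"
proof -
  obtain U f where U: "unitary_on n U" "A = U * diag_real n f * adj U"
      "pos_part A = U * diag_real n (\<lambda>i. max (f i) 0) * adj U"
    using pos_part_spectral[OF assms] by blast
  have "tr_pos A = (\<Sum>i<n. max (f i) 0)"
    unfolding tr_pos_def U(3) mtrace_conj_unitary[OF U(1) diag_real_carrier] mtrace_diag_real by simp
  with U show ?thesis by blast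
qed

text \<open>Together with \<open>tr_pos_attained\<close> this is the variational formula:
  \<open>tr_pos A\<close> is the maximum over all projections. In particular its value does not
  depend on the diagonalization that \<open>pos_part\<close> selects.\<close>

lemma frame_sum_le_tr_pos:
  assumes "hermitian_on n A" "unitary_on n U" "S \<subseteq> {..<n}"
  shows "frame_sum n U S A \<le> tr_pos A"
  using tr_pos_spectral[OF assms(1)] frame_sum_spectral_le[OF _ assms(2,3)] by metis

lemma congruence_spectral:
  assumes "unitary_on n U" "D \<in> carrier_mat n n"
  shows "adj U * (U * D * adj U) * U = D"
proof -
  note c = unitary_onD[OF assms(1)]
  have "adj U * (U * D * adj U) * U = (adj U * U) * D * (adj U * U)"
    using c(1) assms(2) by (simp add: assoc_mult_mat[of _ n n _ n _ n])
  then show ?thesis using c assms(2) by simp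
qed

text \<open>The projection onto the eigenvectors with positive eigenvalue is optimal.\<close>

lemma tr_pos_attained:
  assumes "hermitian_on n A"
  shows "\<exists>U S. unitary_on n U \<and> S \<subseteq> {..<n} \<and> tr_pos A = frame_sum n U S A"
proof -
  obtain U f where U: "unitary_on n U" "A = U * diag_real n f * adj U" "tr_pos A = (\<Sum>i<n. max (f i) 0)"
    using tr_pos_spectral[OF assms] by blast
  define S where "S = {i. i < n \<and> f i > 0}"
  have S: "S \<subseteq> {..<n}" by (auto simp: S_def)
  have "frame_sum n U S A = (\<Sum>i\<in>S. f i)"
    using S unitary_onD(1)[OF U(1)]
    by (subst frame_sum_eq) (auto simp: hermitian_onD[OF assms] U(2) congruence_spectral[OF U(1)] intro!: sum.cong)
  also have "\<dots> = (\<Sum>i<n. max (f i) 0)"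
    by (rule sum.mono_neutral_cong_left) (auto simp: S_def)
  finally have "tr_pos A = frame_sum n U S A" using U(3) by simp
  then show ?thesis using U(1) S by blast
qed

section \<open>Positive semidefinite matrices and the Jordan decomposition\<close>

lemma psd_on_hermitian: "psd_on n A \<Longrightarrow> hermitian_on n A"
  by (simp add: psd_on_def)

text \<open>The quadratic form at \<open>v\<close> is the sum of the squared moduli of the
  coordinates of \<open>V v\<close>, weighted by \<open>f\<close>. The matrix \<open>V\<close> may
  be rectangular.\<close>

lemma psd_on_congruence_diag:
  assumes V: "V \<in> carrier_mat n m" and f: "\<And>i. i < n \<Longrightarrow> f i \<ge> 0"
  shows "psd_on m (adj V * diag_real n f * V)"
  unfolding psd_on_def hermitian_on_def
proof (intro conjI ballI)
  show "adj V * diag_real n f * V \<in> carrier_mat m m" using V by auto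
  show "adj (adj V * diag_real n f * V) = adj V * diag_real n f * V"
    using V by (subst adj_mult[of _ m n _ m], auto, subst adj_mult[of _ m n _ n])
      (auto simp: assoc_mult_mat[of _ m n _ n _ m])
  fix v :: "complex vec" assume "v \<in> carrier_vec m"
  define w where "w k = (\<Sum>j<m. V $$ (k,j) * vec_index v j)" for k
  have "(\<Sum>i<m. \<Sum>j<m. cnj (vec_index v i) * (adj V * diag_real n f * V) $$ (i,j) * vec_index v j)
      = (\<Sum>i<m. \<Sum>j<m. \<Sum>k<n. f k * (cnj (V $$ (k,i) * vec_index v i) * (V $$ (k,j) * vec_index v j)))"
    by (intro sum.cong refl)
      (auto simp: index_congruence_diag[OF V] sum_distrib_left sum_distrib_right algebra_simps simp del: index_mult_mat)
  also have "\<dots> = (\<Sum>i<m. \<Sum>k<n. \<Sum>j<m. f k * (cnj (V $$ (k,i) * vec_index v i) * (V $$ (k,j) * vec_index v j)))"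
    by (intro sum.cong[OF refl], subst sum.swap) simp
  also have "\<dots> = (\<Sum>k<n. \<Sum>i<m. \<Sum>j<m. f k * (cnj (V $$ (k,i) * vec_index v i) * (V $$ (k,j) * vec_index v j)))"
    by (rule sum.swap)
  also have "\<dots> = (\<Sum>k<n. f k * (cnj (w k) * w k))"
  proof (rule sum.cong[OF refl])
    fix k
    have "cnj (w k) * w k = (\<Sum>i<m. \<Sum>j<m. cnj (V $$ (k,i) * vec_index v i) * (V $$ (k,j) * vec_index v j))"
      unfolding w_def cnj_sum by (rule sum_product)
    then show "(\<Sum>i<m. \<Sum>j<m. f k * (cnj (V $$ (k,i) * vec_index v i) * (V $$ (k,j) * vec_index v j)))
        = f k * (cnj (w k) * w k)" by (simp add: sum_distrib_left)
  qed
  also have "\<dots> = complex_of_real (\<Sum>k<n. f k * (cmod (w k))\<^sup>2)"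
    by (simp only: of_real_sum of_real_mult complex_norm_square) (simp add: mult.commute)
  finally show "0 \<le> Re (\<Sum>i<m. \<Sum>j<m. cnj (vec_index v i) * (adj V * diag_real n f * V) $$ (i,j) * vec_index v j)"
    using f by (auto intro!: sum_nonneg)
qed

lemma psd_on_spectral:
  assumes "unitary_on n U" "\<And>i. i < n \<Longrightarrow> f i \<ge> 0"
  shows "psd_on n (U * diag_real n f * adj U)"
  using psd_on_congruence_diag[of "adj U" n n f] assms unitary_onD(1)[OF assms(1)] by simp

lemma psd_on_smult:
  assumes "psd_on n A" "c \<ge> 0"
  shows "psd_on n (complex_of_real c \<cdot>\<^sub>m A)"
  unfolding psd_on_def hermitian_on_def
proof (intro conjI ballI)
  note A = hermitian_onD[OF psd_on_hermitian[OF assms(1)]]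
  show "complex_of_real c \<cdot>\<^sub>m A \<in> carrier_mat n n" using A(1) by simp
  show "adj (complex_of_real c \<cdot>\<^sub>m A) = complex_of_real c \<cdot>\<^sub>m A"
    using A(1) by (intro eq_matI) (auto simp: A(3))
  fix v :: "complex vec" assume v: "v \<in> carrier_vec n"
  have "(\<Sum>i<n. \<Sum>j<n. cnj (vec_index v i) * (complex_of_real c \<cdot>\<^sub>m A) $$ (i,j) * vec_index v j)
      = complex_of_real c * (\<Sum>i<n. \<Sum>j<n. cnj (vec_index v i) * A $$ (i,j) * vec_index v j)"
    using A(1) by (simp add: sum_distrib_left algebra_simps)
  then show "0 \<le> Re (\<Sum>i<n. \<Sum>j<n. cnj (vec_index v i) * (complex_of_real c \<cdot>\<^sub>m A) $$ (i,j) * vec_index v j)"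
    using assms v by (auto simp: psd_on_def)
qed

lemma mtrace_minus: "A \<in> carrier_mat n n \<Longrightarrow> B \<in> carrier_mat n n \<Longrightarrow> mtrace (A - B) = mtrace A - mtrace B"
  by (subst mtrace_carrier[of _ n], rule minus_carrier_mat) (auto simp: mtrace_carrier[of _ n] sum_subtractf)

lemma mtrace_smult: "A \<in> carrier_mat n n \<Longrightarrow> mtrace (c \<cdot>\<^sub>m A) = c * mtrace A"
  by (simp add: mtrace_carrier[of _ n] sum_distrib_left)

lemma hermitian_on_diff:
  assumes "hermitian_on n A" "hermitian_on n B"
  shows "hermitian_on n (A - complex_of_real c \<cdot>\<^sub>m B)"
  unfolding hermitian_on_def
  using hermitian_onD[OF assms(1)] hermitian_onD[OF assms(2)]
  by (auto intro!: eq_matI)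

text \<open>The eigenvalues are split by sign. The last clause serves the case in which
  \<open>P\<close> has trace zero and cannot be normalized to a state.\<close>

lemma jordan_decomposition:
  assumes "hermitian_on n A"
  shows "\<exists>P N p q. psd_on n P \<and> psd_on n N \<and> A = P - N \<and> mtrace P = complex_of_real p \<and>
    mtrace N = complex_of_real q \<and> 0 \<le> p \<and> p = tr_pos A \<and> (p = 0 \<longrightarrow> P = 0\<^sub>m n n)"
proof -
  obtain U f where U: "unitary_on n U" "A = U * diag_real n f * adj U" "tr_pos A = (\<Sum>i<n. max (f i) 0)"
    using tr_pos_spectral[OF assms] by blast
  note c = unitary_onD(1)[OF U(1)]
  let ?P = "U * diag_real n (\<lambda>i. max (f i) 0) * adj U"
  let ?N = "U * diag_real n (\<lambda>i. max (- f i) 0) * adj U"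
  have "diag_real n f = diag_real n (\<lambda>i. max (f i) 0) - diag_real n (\<lambda>i. max (- f i) 0)"
    by (rule eq_matI) (auto simp: max_def)
  then have "A = ?P - ?N"
    using c U(2) by (simp add: mult_minus_distrib_mat[of _ n n _ n] minus_mult_distrib_mat[of _ n n _ _ n])
  moreover have "?P = 0\<^sub>m n n" if "(\<Sum>i<n. max (f i) 0) = 0"
  proof -
    have "\<forall>i\<in>{..<n}. max (f i) 0 = 0" using that by (subst (asm) sum_nonneg_eq_0_iff) auto
    then have "diag_real n (\<lambda>i. max (f i) 0) = 0\<^sub>m n n"
      by (intro eq_matI) auto
    then show ?thesis using c by (simp add: left_mult_zero_mat[of _ n n])
  qed
  ultimately show ?thesis
    using psd_on_spectral[OF U(1)] U(3) mtrace_conj_unitary[OF U(1) diag_real_carrier]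
    by (intro exI[of _ ?P] exI[of _ ?N] exI[of _ "\<Sum>i<n. max (f i) 0"] exI[of _ "\<Sum>i<n. max (- f i) 0"])
      (auto simp: mtrace_diag_real sum_nonneg)
qed

subsection \<open>Contraction under private channels\<close>

lemma densityD:
  assumes "density n \<rho>"
  shows "psd_on n \<rho>" "hermitian_on n \<rho>" "\<rho> \<in> carrier_mat n n" "mtrace \<rho> = 1"
  using assms by (auto simp: density_def psd_on_def hermitian_on_def)

lemma E_hs_eq_tr_pos: "E_hs \<gamma> \<rho> \<sigma> = tr_pos (\<rho> - complex_of_real \<gamma> \<cdot>\<^sub>m \<sigma>)"
  by (simp add: E_hs_def tr_pos_def)

lemma frame_sum_diff:
  assumes "A \<in> carrier_mat n n" "B \<in> carrier_mat n n"
  shows "frame_sum n U S (A - complex_of_real c \<cdot>\<^sub>m B) = frame_sum n U S A - c * frame_sum n U S B"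
  using assms by (simp add: frame_sum_minus frame_sum_smult)

text \<open>With \<open>E_hs_attained\<close> this makes \<open>E_hs\<close> a maximum over
  projections. The later inequalities between such divergences evaluate the optimal projection of
  one side on the other side.\<close>

lemma E_hs_ge_frame_sum:
  assumes "hermitian_on n \<rho>" "hermitian_on n \<sigma>" "unitary_on n U" "S \<subseteq> {..<n}"
  shows "frame_sum n U S \<rho> - \<gamma> * frame_sum n U S \<sigma> \<le> E_hs \<gamma> \<rho> \<sigma>"
  using frame_sum_le_tr_pos[OF hermitian_on_diff[OF assms(1,2)] assms(3,4)]
  by (simp add: E_hs_eq_tr_pos frame_sum_diff hermitian_onD(1)[OF assms(1)] hermitian_onD(1)[OF assms(2)])

lemma E_hs_attained:
  assumes "hermitian_on n \<rho>" "hermitian_on n \<sigma>"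
  shows "\<exists>U S. unitary_on n U \<and> S \<subseteq> {..<n} \<and>
           E_hs \<gamma> \<rho> \<sigma> = frame_sum n U S \<rho> - \<gamma> * frame_sum n U S \<sigma>"
  using tr_pos_attained[OF hermitian_on_diff[OF assms]]
  by (simp add: E_hs_eq_tr_pos frame_sum_diff hermitian_onD(1)[OF assms(1)] hermitian_onD(1)[OF assms(2)])

lemma E_hs_nonneg:
  assumes "hermitian_on n \<rho>" "hermitian_on n \<sigma>"
  shows "0 \<le> E_hs \<gamma> \<rho> \<sigma>"
  using E_hs_ge_frame_sum[OF assms, of "1\<^sub>m n" "{}"]
  by (simp add: frame_sum_def unitary_on_def)

lemma frame_sum_density_le_1:
  assumes "density n \<rho>" "unitary_on n U" "S \<subseteq> {..<n}"
  shows "frame_sum n U S \<rho> \<le> 1"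
  using frame_sum_compl[OF assms(2) densityD(3)[OF assms(1)] assms(3)]
    frame_sum_nonneg[OF densityD(1)[OF assms(1)], of U "{..<n} - S"] densityD(4)[OF assms(1)] by simp

lemma E_hs_le_1:
  assumes "density n \<rho>" "density n \<sigma>" "\<gamma> \<ge> 0"
  shows "E_hs \<gamma> \<rho> \<sigma> \<le> 1"
proof -
  obtain U S where U: "unitary_on n U" "S \<subseteq> {..<n}"
      and E: "E_hs \<gamma> \<rho> \<sigma> = frame_sum n U S \<rho> - \<gamma> * frame_sum n U S \<sigma>"
    using E_hs_attained[OF densityD(2)[OF assms(1)] densityD(2)[OF assms(2)], of \<gamma>] by blast
  have "0 \<le> \<gamma> * frame_sum n U S \<sigma>"
    using frame_sum_nonneg[OF densityD(1)[OF assms(2)]] assms(3) by simp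
  then show ?thesis using E frame_sum_density_le_1[OF assms(1) U] by linarith
qed

lemma E_hs_antimono:
  assumes "hermitian_on n \<rho>" "psd_on n \<sigma>" "\<gamma> \<le> \<gamma>'"
  shows "E_hs \<gamma>' \<rho> \<sigma> \<le> E_hs \<gamma> \<rho> \<sigma>"
proof -
  obtain U S where U: "unitary_on n U" "S \<subseteq> {..<n}"
      and E: "E_hs \<gamma>' \<rho> \<sigma> = frame_sum n U S \<rho> - \<gamma>' * frame_sum n U S \<sigma>"
    using E_hs_attained[OF assms(1) psd_on_hermitian[OF assms(2)], of \<gamma>'] by blast
  have "\<gamma> * frame_sum n U S \<sigma> \<le> \<gamma>' * frame_sum n U S \<sigma>"
    using frame_sum_nonneg[OF assms(2)] assms(3) by (simp add: mult_right_mono)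
  then show ?thesis
    using E E_hs_ge_frame_sum[OF assms(1) psd_on_hermitian[OF assms(2)] U, of \<gamma>] by linarith
qed

section \<open>Integrability and monotonicity of the integral defining \<open>H_half\<close>\<close>

definition H_integrand :: "complex mat \<Rightarrow> complex mat \<Rightarrow> real \<Rightarrow> real" where
  "H_integrand \<rho> \<sigma> \<gamma> = \<gamma> powr (-3/2) * (E_hs \<gamma> \<rho> \<sigma> + E_hs \<gamma> \<sigma> \<rho>)"

lemma H_half_eq: "H_half \<rho> \<sigma> = 1/2 * integral {1..} (H_integrand \<rho> \<sigma>)"
  unfolding H_half_def H_integrand_def ..

text \<open>Measurability follows from monotonicity in \<gamma>, and both divergences are at most 1,
  so \<open>2 * \<gamma> powr (-3/2)\<close> dominates. Integrals can be compared only once this is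
  known, since \<open>integral\<close> is 0 on functions that are not integrable.\<close>

lemma H_integrand_integrable:
  assumes "density n \<rho>" "density n \<sigma>"
  shows "H_integrand \<rho> \<sigma> integrable_on {1..}"
proof (rule measurable_bounded_by_integrable_imp_integrable)
  have m: "(\<lambda>\<gamma>. E_hs \<gamma> \<rho> \<sigma>) \<in> borel_measurable borel"
    if "density n \<rho>" "density n \<sigma>" for \<rho> \<sigma>
  proof -
    \<comment> \<open>The divergence decreases in \<gamma>; its negative is increasing, as
      \<open>borel_measurable_mono\<close> expects.\<close>
    have "(\<lambda>\<gamma>. - E_hs \<gamma> \<rho> \<sigma>) \<in> borel_measurable borel"
      by (rule borel_measurable_mono)
        (auto intro!: monoI E_hs_antimono densityD[OF that(1)] densityD[OF that(2)])
    then have "(\<lambda>\<gamma>. - (- E_hs \<gamma> \<rho> \<sigma>)) \<in> borel_measurable borel" by measurable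
    then show ?thesis by simp
  qed
  have "H_integrand \<rho> \<sigma> \<in> borel_measurable borel"
    unfolding H_integrand_def using m[OF assms] m[OF assms(2,1)] by measurable
  then show "H_integrand \<rho> \<sigma> \<in> borel_measurable (lebesgue_on {1..})"
    by (intro measurable_restrict_space1 measurable_completion) simp
  have "((\<lambda>x::real. x powr (-3/2)) has_integral - (1 powr (-3/2 + 1)) / (-3/2 + 1)) {1..}"
    by (rule has_integral_powr_to_inf) auto
  then have "(\<lambda>x::real. x powr (-3/2)) integrable_on {1..}" by blast
  from integrable_on_cmult_left[OF this, of 2]
  show "(\<lambda>x::real. 2 * x powr (-3/2)) integrable_on {1..}" by simp
  fix \<gamma> :: real assume "\<gamma> \<in> {1..}"
  then have g: "\<gamma> \<ge> 0" by simp
  have "E_hs \<gamma> \<rho> \<sigma> + E_hs \<gamma> \<sigma> \<rho> \<le> 2"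
    using E_hs_le_1[OF assms g] E_hs_le_1[OF assms(2,1) g] by simp
  then have "\<gamma> powr (-3/2) * (E_hs \<gamma> \<rho> \<sigma> + E_hs \<gamma> \<sigma> \<rho>) \<le> \<gamma> powr (-3/2) * 2"
    by (rule mult_left_mono) simp
  moreover have "0 \<le> E_hs \<gamma> \<rho> \<sigma> + E_hs \<gamma> \<sigma> \<rho>"
    using E_hs_nonneg densityD(2) assms by (metis add_nonneg_nonneg)
  ultimately show "norm (H_integrand \<rho> \<sigma> \<gamma>) \<le> 2 * \<gamma> powr (-3/2)"
    by (simp add: H_integrand_def abs_mult)
qed simp

lemma H_half_nonneg:
  assumes "density n \<rho>" "density n \<sigma>"
  shows "0 \<le> H_half \<rho> \<sigma>"
  unfolding H_half_eq
  using integral_nonneg[OF H_integrand_integrable[OF assms]]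
    E_hs_nonneg[OF densityD(2)[OF assms(1)] densityD(2)[OF assms(2)]]
    E_hs_nonneg[OF densityD(2)[OF assms(2)] densityD(2)[OF assms(1)]]
  by (auto simp: H_integrand_def)

text \<open>Serves two purposes: with \<open>c\<close> the contraction coefficient of a private
  channel, and with \<open>c = 1\<close> for depolarization.\<close>

lemma H_half_mono:
  assumes "density n \<rho>" "density n \<sigma>" "density m \<rho>'" "density m \<sigma>'"
    and "\<And>\<gamma>. \<gamma> \<ge> 1 \<Longrightarrow> E_hs \<gamma> \<rho>' \<sigma>' \<le> c * E_hs \<gamma> \<rho> \<sigma>"
    and "\<And>\<gamma>. \<gamma> \<ge> 1 \<Longrightarrow> E_hs \<gamma> \<sigma>' \<rho>' \<le> c * E_hs \<gamma> \<sigma> \<rho>"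
  shows "H_half \<rho>' \<sigma>' \<le> c * H_half \<rho> \<sigma>"
proof -
  have i: "(\<lambda>\<gamma>. c * H_integrand \<rho> \<sigma> \<gamma>) integrable_on {1..}"
    using integrable_on_cmult_left[OF H_integrand_integrable[OF assms(1,2)], of c] by simp
  have "integral {1..} (H_integrand \<rho>' \<sigma>') \<le> integral {1..} (\<lambda>\<gamma>. c * H_integrand \<rho> \<sigma> \<gamma>)"
  proof (rule integral_le[OF H_integrand_integrable[OF assms(3,4)] i])
    fix \<gamma> :: real assume "\<gamma> \<in> {1..}"
    then have "E_hs \<gamma> \<rho>' \<sigma>' + E_hs \<gamma> \<sigma>' \<rho>' \<le> c * (E_hs \<gamma> \<rho> \<sigma> + E_hs \<gamma> \<sigma> \<rho>)"
      using assms(5,6)[of \<gamma>] by (simp add: algebra_simps)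
    then have "\<gamma> powr (-3/2) * (E_hs \<gamma> \<rho>' \<sigma>' + E_hs \<gamma> \<sigma>' \<rho>')
        \<le> \<gamma> powr (-3/2) * (c * (E_hs \<gamma> \<rho> \<sigma> + E_hs \<gamma> \<sigma> \<rho>))"
      by (rule mult_left_mono) simp
    then show "H_integrand \<rho>' \<sigma>' \<gamma> \<le> c * H_integrand \<rho> \<sigma> \<gamma>"
      by (simp add: H_integrand_def mult.left_commute)
  qed
  then show ?thesis by (simp add: H_half_eq)
qed

section \<open>Channels and local privacy\<close>

lemma channel_carrier:
  "channel dA dB \<Phi> \<Longrightarrow> X \<in> carrier_mat dA dA \<Longrightarrow> \<Phi> X \<in> carrier_mat dB dB"
  by (simp add: channel_def)

lemma channel_smult:
  "channel dA dB \<Phi> \<Longrightarrow> X \<in> carrier_mat dA dA \<Longrightarrow> \<Phi> (c \<cdot>\<^sub>m X) = c \<cdot>\<^sub>m \<Phi> X"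
  by (simp add: channel_def)

lemma channel_diff:
  assumes ch: "channel dA dB \<Phi>" and X: "X \<in> carrier_mat dA dA" and Y: "Y \<in> carrier_mat dA dA"
  shows "\<Phi> (X - c \<cdot>\<^sub>m Y) = \<Phi> X - c \<cdot>\<^sub>m \<Phi> Y"
proof -
  have "X - c \<cdot>\<^sub>m Y = X + (- c) \<cdot>\<^sub>m Y" using X Y by (intro eq_matI) auto
  then have "\<Phi> (X - c \<cdot>\<^sub>m Y) = \<Phi> X + (- c) \<cdot>\<^sub>m \<Phi> Y"
    using ch X Y by (simp add: channel_def)
  also have "\<dots> = \<Phi> X - c \<cdot>\<^sub>m \<Phi> Y"
    using channel_carrier[OF ch X] channel_carrier[OF ch Y] by (intro eq_matI) auto
  finally show ?thesis .
qed

text \<open>This is complete positivity with a one-dimensional ancilla, where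
  \<open>id_tensor\<close> reduces to the channel itself.\<close>

lemma channel_psd:
  assumes ch: "channel dA dB \<Phi>" and X: "psd_on dA X"
  shows "psd_on dB (\<Phi> X)"
proof -
  have Xc: "X \<in> carrier_mat dA dA" using X by (simp add: psd_on_def hermitian_on_def)
  have "blk dA X 0 0 = X" using Xc by (intro eq_matI) (auto simp: blk_def)
  then have "id_tensor 1 dA dB \<Phi> X = \<Phi> X"
    using channel_carrier[OF ch Xc] by (intro eq_matI) (auto simp: id_tensor_def)
  moreover have "psd_on (1 * dB) (id_tensor 1 dA dB \<Phi> X)"
    using ch X unfolding channel_def by (metis mult_1)
  ultimately show ?thesis by simp
qed

lemma channel_density:
  assumes "channel dA dB \<Phi>" "density dA \<rho>"
  shows "density dB (\<Phi> \<rho>)"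
  using channel_psd[OF assms(1) densityD(1)[OF assms(2)]] assms densityD(3,4)[OF assms(2)]
  by (simp add: density_def channel_def)

text \<open>Let \<open>a\<close> and \<open>b\<close> be the two probabilities of the projection.
  Privacy on \<open>S\<close>, and privacy on the complement with the states exchanged, give
  \<open>a - exp \<epsilon> * b \<le> 0\<close> and
  \<open>(1 - b) - exp \<epsilon> * (1 - a) \<le> 0\<close>. Adding the two yields the
  bound.\<close>

lemma LDP_frame_sum_diff_le:
  assumes L: "LDP \<epsilon> dA dB \<Phi>" and \<tau>: "density dA \<tau>" and \<omega>: "density dA \<omega>"
    and U: "unitary_on dB U" "S \<subseteq> {..<dB}"
  shows "frame_sum dB U S (\<Phi> \<tau>) - frame_sum dB U S (\<Phi> \<omega>) \<le> (exp \<epsilon> - 1) / (exp \<epsilon> + 1)"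
proof -
  have ch: "channel dA dB \<Phi>" using L by (simp add: LDP_def)
  note t = densityD[OF channel_density[OF ch \<tau>]] and o = densityD[OF channel_density[OF ch \<omega>]]
  have 1: "frame_sum dB U S (\<Phi> \<tau>) - exp \<epsilon> * frame_sum dB U S (\<Phi> \<omega>) \<le> 0"
    using E_hs_ge_frame_sum[OF t(2) o(2) U, of "exp \<epsilon>"] L \<tau> \<omega> by (simp add: LDP_def)
  have "frame_sum dB U ({..<dB} - S) (\<Phi> \<omega>) - exp \<epsilon> * frame_sum dB U ({..<dB} - S) (\<Phi> \<tau>) \<le> 0"
    using E_hs_ge_frame_sum[OF o(2) t(2) U(1), of "{..<dB} - S" "exp \<epsilon>"] L \<tau> \<omega> by (simp add: LDP_def)
  then have 2: "1 - frame_sum dB U S (\<Phi> \<omega>) - exp \<epsilon> * (1 - frame_sum dB U S (\<Phi> \<tau>)) \<le> 0"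
    by (simp add: frame_sum_compl[OF U(1) t(3) U(2)] frame_sum_compl[OF U(1) o(3) U(2)] t(4) o(4))
  have "(frame_sum dB U S (\<Phi> \<tau>) - frame_sum dB U S (\<Phi> \<omega>)) * (exp \<epsilon> + 1) \<le> exp \<epsilon> - 1"
    using 1 2 by (simp add: algebra_simps)
  moreover have "exp \<epsilon> + 1 > 0" by (simp add: add_pos_pos)
  ultimately show ?thesis by (simp add: pos_le_divide_eq)
qed

lemma density_normalize:
  assumes "psd_on n P" "mtrace P = complex_of_real p" "p > 0"
  shows "density n (complex_of_real (1/p) \<cdot>\<^sub>m P)"
    and "P = complex_of_real p \<cdot>\<^sub>m (complex_of_real (1/p) \<cdot>\<^sub>m P)"
proof -
  have P: "P \<in> carrier_mat n n" using assms(1) by (simp add: psd_on_def hermitian_on_def)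
  have "complex_of_real (1/p) * complex_of_real p = 1" using assms(3) by simp
  then show "density n (complex_of_real (1/p) \<cdot>\<^sub>m P)"
    unfolding density_def using psd_on_smult[OF assms(1), of "1/p"] assms(2,3)
    by (simp add: mtrace_smult[OF P])
  show "P = complex_of_real p \<cdot>\<^sub>m (complex_of_real (1/p) \<cdot>\<^sub>m P)"
    using P assms(3) by (intro eq_matI) auto
qed

lemma LDP_contraction:
  assumes L: "LDP \<epsilon> dA dB \<Phi>" and \<rho>: "density dA \<rho>" and \<sigma>: "density dA \<sigma>" and g: "\<gamma> \<ge> 1"
  shows "E_hs \<gamma> (\<Phi> \<rho>) (\<Phi> \<sigma>) \<le> (exp \<epsilon> - 1) / (exp \<epsilon> + 1) * E_hs \<gamma> \<rho> \<sigma>"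
proof -
  let ?A = "\<rho> - complex_of_real \<gamma> \<cdot>\<^sub>m \<sigma>"
  have ch: "channel dA dB \<Phi>" using L by (simp add: LDP_def)
  note r = densityD[OF \<rho>] and s = densityD[OF \<sigma>]
  obtain P N p q where PN: "psd_on dA P" "psd_on dA N" "?A = P - N" "mtrace P = complex_of_real p"
      "mtrace N = complex_of_real q" "0 \<le> p" "p = tr_pos ?A" "p = 0 \<Longrightarrow> P = 0\<^sub>m dA dA"
    using jordan_decomposition[OF hermitian_on_diff[OF r(2) s(2), of \<gamma>]] by blast
  have Pc: "P \<in> carrier_mat dA dA" and Nc: "N \<in> carrier_mat dA dA"
    using PN by (auto simp: psd_on_def hermitian_on_def)
  have pE: "p = E_hs \<gamma> \<rho> \<sigma>" using PN by (simp add: E_hs_eq_tr_pos)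
  \<comment> \<open>Comparing traces gives \<open>p - q = 1 - \<gamma>\<close>, which is where
    \<open>\<gamma> \<ge> 1\<close> enters: it makes \<open>p \<le> q\<close>.\<close>
  have "mtrace ?A = 1 - complex_of_real \<gamma>"
    using r s by (subst mtrace_minus[of _ dA]) (auto simp: mtrace_smult[of _ dA])
  then have "1 - complex_of_real \<gamma> = complex_of_real p - complex_of_real q"
    using PN Pc Nc by (simp add: mtrace_minus[of _ dA])
  then have "1 - \<gamma> = p - q" by (metis of_real_1 of_real_diff of_real_eq_iff)
  then have pq: "p \<le> q" using g by simp
  obtain U S where U: "unitary_on dB U" "S \<subseteq> {..<dB}"
      and E: "E_hs \<gamma> (\<Phi> \<rho>) (\<Phi> \<sigma>) = frame_sum dB U S (\<Phi> \<rho>) - \<gamma> * frame_sum dB U S (\<Phi> \<sigma>)"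
    using E_hs_attained[OF densityD(2)[OF channel_density[OF ch \<rho>]] densityD(2)[OF channel_density[OF ch \<sigma>]], of \<gamma>]
    by blast
  let ?fs = "\<lambda>X. frame_sum dB U S (\<Phi> X)"
  note c = channel_carrier[OF ch]
  \<comment> \<open>The factor 1 brings \<open>P - N\<close> into the form treated by
    \<open>channel_diff\<close> and \<open>frame_sum_diff\<close>.\<close>
  have "\<Phi> ?A = \<Phi> (P - complex_of_real 1 \<cdot>\<^sub>m N)"
    unfolding PN(3) using Nc Pc by (intro arg_cong[of _ _ \<Phi>] eq_matI) auto
  then have "\<Phi> \<rho> - complex_of_real \<gamma> \<cdot>\<^sub>m \<Phi> \<sigma> = \<Phi> P - complex_of_real 1 \<cdot>\<^sub>m \<Phi> N"
    using channel_diff[OF ch] r(3) s(3) Pc Nc by metis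
  then have "E_hs \<gamma> (\<Phi> \<rho>) (\<Phi> \<sigma>) = ?fs P - ?fs N"
    unfolding E using frame_sum_diff[OF c[OF r(3)] c[OF s(3)]] frame_sum_diff[OF c[OF Pc] c[OF Nc]]
    by (metis mult_1)
  also have "\<dots> \<le> (exp \<epsilon> - 1) / (exp \<epsilon> + 1) * p"
  proof (cases "p = 0")
    case True
    \<comment> \<open>Here \<open>P = 0\<close>. By homogeneity its image contributes nothing, and
      the term of \<open>N\<close> can only lower the value.\<close>
    then have "P = complex_of_real 0 \<cdot>\<^sub>m P" using PN(8) by (intro eq_matI) auto
    then have "\<Phi> P = complex_of_real 0 \<cdot>\<^sub>m \<Phi> P" using channel_smult[OF ch Pc] by metis
    then have "?fs P = 0 * ?fs P" using frame_sum_smult[OF c[OF Pc]] by metis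
    then show ?thesis using True frame_sum_nonneg[OF channel_psd[OF ch PN(2)]] by simp
  next
    case False
    then have p: "p > 0" and q: "q > 0" using PN(6) pq by auto
    let ?T = "complex_of_real (1/p) \<cdot>\<^sub>m P" and ?W = "complex_of_real (1/q) \<cdot>\<^sub>m N"
    note T = density_normalize[OF PN(1,4) p] and W = density_normalize[OF PN(2,5) q]
    have "?fs P = p * ?fs ?T"
      by (subst T(2), subst channel_smult[OF ch densityD(3)[OF T(1)]])
        (rule frame_sum_smult[OF c[OF densityD(3)[OF T(1)]]])
    moreover have "?fs N = q * ?fs ?W"
      by (subst W(2), subst channel_smult[OF ch densityD(3)[OF W(1)]])
        (rule frame_sum_smult[OF c[OF densityD(3)[OF W(1)]]])
    \<comment> \<open>Since \<open>p \<le> q\<close>, lowering the weight of the second state from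
      \<open>q\<close> to \<open>p\<close> only raises the difference. What remains is
      \<open>p\<close> times a difference of probabilities of two private outputs.\<close>
    moreover have "p * ?fs ?W \<le> q * ?fs ?W"
      using pq frame_sum_nonneg[OF channel_psd[OF ch densityD(1)[OF W(1)]]] by (rule mult_right_mono)
    moreover have "p * (?fs ?T - ?fs ?W) \<le> p * ((exp \<epsilon> - 1) / (exp \<epsilon> + 1))"
      using LDP_frame_sum_diff_le[OF L T(1) W(1) U] p by (intro mult_left_mono) auto
    ultimately show ?thesis by (simp only: right_diff_distrib mult.commute[of p "(exp \<epsilon> - 1) / (exp \<epsilon> + 1)"])
  qed
  finally show ?thesis unfolding pE .
qed

lemma H_half_LDP_le:
  assumes L: "LDP \<epsilon> dA dB \<Phi>" and \<rho>: "density dA \<rho>" and \<sigma>: "density dA \<sigma>"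
  shows "H_half (\<Phi> \<rho>) (\<Phi> \<sigma>) \<le> (exp \<epsilon> - 1) / (exp \<epsilon> + 1) * H_half \<rho> \<sigma>"
proof (rule H_half_mono[OF \<rho> \<sigma>])
  have ch: "channel dA dB \<Phi>" using L by (simp add: LDP_def)
  show "density dB (\<Phi> \<rho>)" "density dB (\<Phi> \<sigma>)" using channel_density[OF ch] \<rho> \<sigma> by auto
qed (use LDP_contraction[OF L] \<rho> \<sigma> in auto)

subsection \<open>The Fuchs-Caves measurement\<close>

text \<open>The integrand vanishes beyond \<open>r = p / q\<close>. On \<open>{1..r}\<close> it has
  the antiderivative \<open>F\<close>, whose boundary values combine to
  \<open>2 * p + 2 * q - 4 * sqrt (p * q)\<close>.\<close>

lemma has_integral_hockey_stick_gt:
  fixes p q :: real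
  assumes "q > 0" "p > q"
  shows "((\<lambda>\<gamma>. \<gamma> powr (-3/2) * max (p - \<gamma> * q) 0) has_integral 2 * (sqrt p - sqrt q)\<^sup>2) {1..}"
proof -
  define r where "r = p / q"
  have p: "p > 0" and r: "r > 1" using assms by (auto simp: r_def)
  define F where "F x = - 2 * p * x powr (-1/2) - 2 * q * x powr (1/2)" for x :: real
  define f where "f x = p * x powr (-3/2) - q * x powr (-1/2)" for x :: real
  have "(f has_integral (F r - F 1)) {1..r}"
  proof (rule fundamental_theorem_of_calculus)
    fix x assume x: "x \<in> {1..r}"
    have "(F has_real_derivative f x) (at x)"
      unfolding F_def f_def using x by (auto intro!: derivative_eq_intros)
    then show "(F has_vector_derivative f x) (at x within {1..r})"
      by (metis has_field_derivative_at_within has_real_derivative_iff_has_vector_derivative)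
  qed (use r in simp)
  moreover have "F r - F 1 = 2 * (sqrt p - sqrt q)\<^sup>2"
  proof -
    have "r powr (1/2) = sqrt p / sqrt q" using p assms by (simp add: r_def powr_half_sqrt real_sqrt_divide)
    moreover have "r powr (-1/2) = sqrt q / sqrt p"
      using calculation by (metis (no_types, opaque_lifting) divide_minus_left inverse_divide powr_minus)
    moreover have "p = sqrt p * sqrt p" "q = sqrt q * sqrt q" using p assms by auto
    moreover have "p * (sqrt q / sqrt p) = sqrt p * sqrt q" "q * (sqrt p / sqrt q) = sqrt p * sqrt q"
      using p assms by (simp_all add: field_simps)
    ultimately have "F r = - 2 * (sqrt p * sqrt q) - 2 * (sqrt p * sqrt q)"
      unfolding F_def by (simp only: mult.assoc)
    then show ?thesis using p assms by (simp add: F_def power2_diff)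
  qed
  moreover have "f x = x powr (-3/2) * max (p - x * q) 0" if "x \<in> {1..r}" for x
  proof -
    have "x * q \<le> p" using that assms by (simp add: r_def pos_le_divide_eq)
    moreover have "x powr (-1/2) = x powr (-3/2) * x"
      using that powr_add[of x "-3/2" 1] by simp
    ultimately show ?thesis by (simp add: f_def max_def algebra_simps)
  qed
  ultimately have "((\<lambda>x. x powr (-3/2) * max (p - x * q) 0) has_integral 2 * (sqrt p - sqrt q)\<^sup>2) {1..r}"
    by (metis (no_types, lifting) has_integral_eq)
  \<comment> \<open>Extension by zero from \<open>{1..r}\<close> to the half-line; beyond
    \<open>r\<close> the positive part is zero anyway.\<close>
  then have "((\<lambda>x. if x \<in> {1..r} then x powr (-3/2) * max (p - x * q) 0 else 0)
      has_integral 2 * (sqrt p - sqrt q)\<^sup>2) {1..}"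
    by (subst has_integral_restrict) auto
  then show ?thesis
  proof (rule has_integral_eq[rotated])
    fix x :: real assume "x \<in> {1..}"
    then show "(if x \<in> {1..r} then x powr (-3/2) * max (p - x * q) 0 else 0) = x powr (-3/2) * max (p - x * q) 0"
      using assms by (auto simp: r_def max_def field_simps)
  qed
qed

lemma has_integral_hockey_stick_le:
  fixes p q :: real
  assumes "q > 0" "p \<le> q"
  shows "((\<lambda>\<gamma>. \<gamma> powr (-3/2) * max (p - \<gamma> * q) 0) has_integral 0) {1..}"
proof (rule has_integral_is_0)
  fix x :: real assume "x \<in> {1..}"
  then have "q \<le> x * q" using assms by simp
  then have "p \<le> x * q" using assms by linarith
  then show "x powr (-3/2) * max (p - x * q) 0 = 0" by simp
qed

text \<open>For \<open>\<gamma> \<ge> 1\<close> only the term led by the larger number contributes.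
  Summed over the outcomes of a measurement, half of this integral is the squared Hellinger distance
  of the outcome distributions.\<close>

lemma has_integral_hockey_stick_sym:
  fixes p q :: real
  assumes "p > 0" "q > 0"
  shows "((\<lambda>\<gamma>. \<gamma> powr (-3/2) * (max (p - \<gamma> * q) 0 + max (q - \<gamma> * p) 0))
           has_integral 2 * (sqrt p - sqrt q)\<^sup>2) {1..}"
proof -
  consider "p = q" | "p > q" | "q > p" by linarith
  then show ?thesis
  proof cases
    case 1
    then show ?thesis
      using has_integral_add[OF has_integral_hockey_stick_le[of q p] has_integral_hockey_stick_le[of p q]] assms
      by (simp add: distrib_left mult_ac)
  next
    case 2
    then show ?thesis
      using has_integral_add[OF has_integral_hockey_stick_gt[of q p] has_integral_hockey_stick_le[of p q]] assms
      by (simp add: distrib_left)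
  next
    case 3
    then show ?thesis
      using has_integral_add[OF has_integral_hockey_stick_le[of q p] has_integral_hockey_stick_gt[of p q]] assms
      by (simp add: distrib_left power2_commute)
  qed
qed

lemma frame_sum_singletons: "frame_sum n U S A = (\<Sum>i\<in>S. frame_sum n U {i} A)"
  by (simp add: frame_sum_def)

text \<open>Data processing for the measurement in the basis \<open>W\<close>: the optimal set of
  outcomes of the classical problem is one particular projection for the quantum problem.\<close>

lemma E_hs_ge_measured:
  assumes "hermitian_on n \<rho>" "hermitian_on n \<sigma>" "unitary_on n W"
  shows "(\<Sum>i<n. max (frame_sum n W {i} \<rho> - \<gamma> * frame_sum n W {i} \<sigma>) 0) \<le> E_hs \<gamma> \<rho> \<sigma>"
proof -
  let ?p = "\<lambda>i. frame_sum n W {i} \<rho>" and ?q = "\<lambda>i. frame_sum n W {i} \<sigma>"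
  define S where "S = {i. i < n \<and> ?p i > \<gamma> * ?q i}"
  have "(\<Sum>i<n. max (?p i - \<gamma> * ?q i) 0) = (\<Sum>i\<in>S. ?p i - \<gamma> * ?q i)"
    by (rule sum.mono_neutral_cong_right) (auto simp: S_def)
  also have "\<dots> = frame_sum n W S \<rho> - \<gamma> * frame_sum n W S \<sigma>"
    unfolding frame_sum_singletons[of n W S] by (simp add: sum_subtractf sum_distrib_left)
  also have "\<dots> \<le> E_hs \<gamma> \<rho> \<sigma>"
    by (rule E_hs_ge_frame_sum[OF assms]) (auto simp: S_def)
  finally show ?thesis .
qed

text \<open>Integrating \<open>E_hs_ge_measured\<close> bounds \<open>H_half\<close> below by the
  sum of the squares of \<open>sqrt p - sqrt q\<close>. As both distributions sum to 1, this sum is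
  2 minus twice the Bhattacharyya sum.\<close>

lemma H_half_ge_measured:
  assumes \<rho>: "density n \<rho>" and \<sigma>: "density n \<sigma>" and W: "unitary_on n W"
    and pos: "\<And>i. i < n \<Longrightarrow> frame_sum n W {i} \<rho> > 0" "\<And>i. i < n \<Longrightarrow> frame_sum n W {i} \<sigma> > 0"
  shows "1 - H_half \<rho> \<sigma> / 2 \<le> (\<Sum>i<n. sqrt (frame_sum n W {i} \<rho> * frame_sum n W {i} \<sigma>))"
proof -
  let ?p = "\<lambda>i. frame_sum n W {i} \<rho>" and ?q = "\<lambda>i. frame_sum n W {i} \<sigma>"
  have int: "((\<lambda>\<gamma>. \<Sum>i<n. \<gamma> powr (-3/2) * (max (?p i - \<gamma> * ?q i) 0 + max (?q i - \<gamma> * ?p i) 0))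
      has_integral (\<Sum>i<n. 2 * (sqrt (?p i) - sqrt (?q i))\<^sup>2)) {1..}"
    by (rule has_integral_sum) (simp, rule has_integral_hockey_stick_sym[OF pos], auto)
  have "(\<Sum>i<n. 2 * (sqrt (?p i) - sqrt (?q i))\<^sup>2) \<le> integral {1..} (H_integrand \<rho> \<sigma>)"
  proof (rule has_integral_le[OF int integrable_integral[OF H_integrand_integrable[OF \<rho> \<sigma>]]])
    fix \<gamma> :: real
    have "(\<Sum>i<n. max (?p i - \<gamma> * ?q i) 0 + max (?q i - \<gamma> * ?p i) 0) \<le> E_hs \<gamma> \<rho> \<sigma> + E_hs \<gamma> \<sigma> \<rho>"
      unfolding sum.distrib
      by (intro add_mono E_hs_ge_measured densityD(2)[OF \<rho>] densityD(2)[OF \<sigma>] W)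
    then have "\<gamma> powr (-3/2) * (\<Sum>i<n. max (?p i - \<gamma> * ?q i) 0 + max (?q i - \<gamma> * ?p i) 0)
        \<le> H_integrand \<rho> \<sigma> \<gamma>"
      unfolding H_integrand_def by (rule mult_left_mono) simp
    then show "(\<Sum>i<n. \<gamma> powr (-3/2) * (max (?p i - \<gamma> * ?q i) 0 + max (?q i - \<gamma> * ?p i) 0)) \<le> H_integrand \<rho> \<sigma> \<gamma>"
      by (simp only: sum_distrib_left)
  qed
  moreover have "(\<Sum>i<n. 2 * (sqrt (?p i) - sqrt (?q i))\<^sup>2)
      = 2 * (\<Sum>i<n. ?p i) + 2 * (\<Sum>i<n. ?q i) - 4 * (\<Sum>i<n. sqrt (?p i * ?q i))"
  proof -
    have "2 * (sqrt (?p i) - sqrt (?q i))\<^sup>2 = 2 * ?p i + 2 * ?q i - 4 * sqrt (?p i * ?q i)" if "i < n" for i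
      using pos[OF that] by (simp add: power2_diff real_sqrt_mult)
    then show ?thesis by (simp add: sum.distrib sum_subtractf sum_distrib_left)
  qed
  moreover have "(\<Sum>i<n. frame_sum n W {i} A) = Re (mtrace A)" if "A \<in> carrier_mat n n" for A
    using frame_sum_full[OF W that] by (simp add: frame_sum_def)
  ultimately show ?thesis using densityD(3,4)[OF \<rho>] densityD(3,4)[OF \<sigma>] by (simp add: H_half_eq)
qed

section \<open>Square roots and inverses of positive matrices\<close>

lemma frame_sum_spectral_single:
  assumes "unitary_on n U" "i < n"
  shows "frame_sum n U {i} (U * diag_real n f * adj U) = f i"
  using assms unitary_onD(1)[OF assms(1)] by (subst frame_sum_eq) (auto simp: congruence_spectral)

lemma spectral_nonneg:
  assumes "psd_on n A"
  shows "\<exists>U f. unitary_on n U \<and> A = U * diag_real n f * adj U \<and> (\<forall>i<n. f i \<ge> 0)"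
proof -
  obtain U f where U: "unitary_on n U" "A = U * diag_real n f * adj U"
    using spectral_decomposition[OF psd_on_hermitian[OF assms]] by blast
  then have "\<forall>i<n. f i \<ge> 0"
    using frame_sum_nonneg[OF assms] frame_sum_spectral_single[OF U(1)] by metis
  with U show ?thesis by blast
qed

lemma psd_on_congruence:
  assumes "psd_on n A" "V \<in> carrier_mat n m"
  shows "psd_on m (adj V * A * V)"
proof -
  obtain U f where U: "unitary_on n U" "A = U * diag_real n f * adj U" "\<forall>i<n. f i \<ge> 0"
    using spectral_nonneg[OF assms(1)] by blast
  have Uc: "U \<in> carrier_mat n n" by (rule unitary_onD(1)[OF U(1)])
  have "adj (adj U * V) * diag_real n f * (adj U * V) = adj V * A * V"
    using Uc assms(2) unfolding U(2)
    by (subst adj_mult[of _ n n _ m]) (simp_all add: assoc_mult_mat[of _ m n _ n _ m] assoc_mult_mat[of _ m n _ n _ n] assoc_mult_mat[of _ n n _ n _ m]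
        assoc_mult_mat[of _ n n _ n _ n] mult_carrier_mat[of _ m n _ n] mult_carrier_mat[of _ n n _ m])
  moreover have "psd_on m (adj (adj U * V) * diag_real n f * (adj U * V))"
    by (rule psd_on_congruence_diag[of _ n]) (use Uc assms(2) U(3) in auto)
  ultimately show ?thesis by simp
qed

lemma spectral_mult:
  assumes "unitary_on n U"
  shows "(U * diag_real n f * adj U) * (U * diag_real n g * adj U) = U * diag_real n (\<lambda>i. f i * g i) * adj U"
proof -
  note c = unitary_onD[OF assms]
  have "(U * diag_real n f * adj U) * (U * diag_real n g * adj U)
      = U * diag_real n f * (adj U * U) * diag_real n g * adj U"
    using c(1) by (simp add: assoc_mult_mat[of _ n n _ n _ n])
  also have "\<dots> = U * (diag_real n f * diag_real n g) * adj U"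
    using c(1,3) by (simp add: assoc_mult_mat[of _ n n _ n _ n])
  finally show ?thesis by (simp add: diag_real_mult)
qed

lemma psd_sqrt:
  assumes "psd_on n A"
  shows "\<exists>K. psd_on n K \<and> K * K = A"
proof -
  obtain U f where U: "unitary_on n U" "A = U * diag_real n f * adj U" "\<forall>i<n. f i \<ge> 0"
    using spectral_nonneg[OF assms] by blast
  let ?K = "U * diag_real n (\<lambda>i. sqrt (f i)) * adj U"
  have "diag_real n (\<lambda>i. sqrt (f i) * sqrt (f i)) = diag_real n f"
    using U(3) by (intro eq_matI) auto
  then have "?K * ?K = A" unfolding spectral_mult[OF U(1)] U(2) by simp
  moreover have "psd_on n ?K" by (rule psd_on_spectral[OF U(1)]) (use U(3) in auto)
  ultimately show ?thesis by blast
qed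

text \<open>The eigenvalues are frame sums over single columns, so the hypothesis makes them
  positive. \<open>X\<close> is the square root of \<open>A\<close>, and \<open>Z\<close> is the
  inverse of \<open>X\<close>.\<close>

lemma posdef_sqrt_inverse:
  assumes A: "hermitian_on n A" and pos: "\<And>U i. unitary_on n U \<Longrightarrow> i < n \<Longrightarrow> frame_sum n U {i} A > 0"
  shows "\<exists>X Z. hermitian_on n X \<and> hermitian_on n Z \<and> X * X = A \<and> X * Z = 1\<^sub>m n \<and> Z * X = 1\<^sub>m n"
proof -
  obtain U f where U: "unitary_on n U" "A = U * diag_real n f * adj U"
    using spectral_decomposition[OF A] by blast
  note c = unitary_onD[OF U(1)]
  have f: "f i > 0" if "i < n" for i
    using pos[OF U(1) that] frame_sum_spectral_single[OF U(1) that, of f] U(2) by simp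
  let ?X = "U * diag_real n (\<lambda>i. sqrt (f i)) * adj U" and ?Z = "U * diag_real n (\<lambda>i. 1 / sqrt (f i)) * adj U"
  have h: "hermitian_on n (U * diag_real n g * adj U)" for g
    using c(1) by (simp add: hermitian_on_def adj_mult[of _ n n _ n] assoc_mult_mat[of _ n n _ n _ n])
  have "diag_real n (\<lambda>i. sqrt (f i) * sqrt (f i)) = diag_real n f"
    "diag_real n (\<lambda>i. sqrt (f i) * (1 / sqrt (f i))) = 1\<^sub>m n"
    "diag_real n (\<lambda>i. 1 / sqrt (f i) * sqrt (f i)) = 1\<^sub>m n"
    using f by (auto intro!: eq_matI simp: less_imp_le) (fastforce dest: f)+
  then have "?X * ?X = A" "?X * ?Z = 1\<^sub>m n" "?Z * ?X = 1\<^sub>m n"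
    unfolding spectral_mult[OF U(1)] using U(2) c by simp_all
  then show ?thesis using h by blast
qed

lemma index_mult_diag:
  assumes "B \<in> carrier_mat n m" "i < n" "j < m"
  shows "(B * diag_real m f) $$ (i,j) = B $$ (i,j) * complex_of_real (f j)"
proof -
  have "(B * diag_real m f) $$ (i,j) = (\<Sum>l<m. B $$ (i,l) * diag_real m f $$ (l,j))"
    by (rule index_mult_sum) (use assms in auto)
  also have "\<dots> = (\<Sum>l<m. if l = j then B $$ (i,l) * complex_of_real (f j) else 0)"
    by (rule sum.cong) (use assms in auto)
  finally show ?thesis using assms by simp
qed

text \<open>Measuring in the eigenbasis of the positive \<open>M\<close> with \<open>M R M = S\<close>, the outcome distributions
  satisfy \<open>q\<^sub>i = m\<^sub>i\<^sup>2 p\<^sub>i\<close>, so their Bhattacharyya sum is \<open>\<Sum>i. m\<^sub>i p\<^sub>i = Tr (M R)\<close>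
  (Fuchs and Caves).\<close>

lemma fuchs_caves:
  assumes R: "hermitian_on n R" and S: "psd_on n S"
    and pos: "\<And>U i. unitary_on n U \<Longrightarrow> i < n \<Longrightarrow> frame_sum n U {i} R > 0"
  shows "\<exists>X Y W. X \<in> carrier_mat n n \<and> Y \<in> carrier_mat n n \<and> unitary_on n W \<and>
    X * adj X = R \<and> Y * adj Y = S \<and>
    Re (mtrace (adj X * Y)) = (\<Sum>i<n. sqrt (frame_sum n W {i} R * frame_sum n W {i} S))"
proof -
  note as = assoc_mult_mat[of _ n n _ n _ n]
  obtain X Z where X: "hermitian_on n X" and Z: "hermitian_on n Z"
      and XX: "X * X = R" and XZ: "X * Z = 1\<^sub>m n" "Z * X = 1\<^sub>m n"
    using posdef_sqrt_inverse[OF R pos] by blast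
  note X = hermitian_onD(1,2)[OF X] and Z = hermitian_onD(1,2)[OF Z]
  have Rc: "R \<in> carrier_mat n n" by (rule hermitian_onD(1)[OF R])
  have Sc: "S \<in> carrier_mat n n" using S by (simp add: psd_on_def hermitian_on_def)
  have "psd_on n (X * S * X)" using psd_on_congruence[OF S X(1)] X(2) by simp
  then obtain K where K: "psd_on n K" "K * K = X * S * X" using psd_sqrt by blast
  have Kc: "K \<in> carrier_mat n n" using K by (simp add: psd_on_def hermitian_on_def)
  \<comment> \<open>\<open>X\<close> is the square root of \<open>R\<close>, \<open>Z\<close> its
    inverse and \<open>K\<close> the square root of \<open>X * S * X\<close>. Hence \<open>M\<close>
    is the geometric mean of the inverse of \<open>R\<close> and of \<open>S\<close>, which solves
    \<open>M * R * M = S\<close>.\<close>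
  define M where "M = Z * K * Z"
  have M: "psd_on n M" using psd_on_congruence[OF K(1) Z(1)] Z(2) by (simp add: M_def)
  note Mh = hermitian_onD(1,2)[OF psd_on_hermitian[OF M]]
  have "M * X * (X * M) = Z * K * (Z * X) * (X * Z) * K * Z"
    unfolding M_def using X(1) Z(1) Kc by (simp add: as)
  also have "\<dots> = Z * (K * K) * Z" using XZ Z(1) Kc by (simp add: as)
  also have "\<dots> = (Z * X) * S * (X * Z)" unfolding K(2) using X(1) Z(1) Sc by (simp add: as)
  finally have MXXM: "M * X * (X * M) = S" using XZ Sc by simp
  then have MRM: "M * R * M = S" unfolding XX[symmetric] using X(1) Mh(1) by (simp add: as)
  obtain W m where W: "unitary_on n W" "M = W * diag_real n m * adj W" "\<forall>i<n. m i \<ge> 0"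
    using spectral_nonneg[OF M] by blast
  note Wc = unitary_onD[OF W(1)]
  let ?D = "diag_real n m"
  define B where "B = adj W * R * W"
  have Bc: "B \<in> carrier_mat n n" using Wc(1) Rc by (simp add: B_def)
  have pB: "frame_sum n W {i} R = Re (B $$ (i,i))" if "i < n" for i
    using that Wc(1) Rc by (simp add: frame_sum_eq B_def)
  have "adj W * S * W = (adj W * W) * ?D * B * ?D * (adj W * W)"
    unfolding MRM[symmetric] W(2) B_def using Wc(1) Rc by (simp add: as)
  \<comment> \<open>In the eigenbasis of \<open>M\<close> the matrix \<open>S\<close> is
    \<open>B\<close> scaled on both sides by the eigenvalues, so its diagonal is that of
    \<open>B\<close> times the squares of the \<open>m i\<close>.\<close>
  then have SB: "adj W * S * W = ?D * B * ?D" using Wc Bc by simp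
  have q: "frame_sum n W {i} S = m i * m i * Re (B $$ (i,i))" if "i < n" for i
  proof -
    have "(?D * B * ?D) $$ (i,i) = complex_of_real (m i) * B $$ (i,i) * complex_of_real (m i)"
      using that Bc by (simp add: index_mult_diag[of _ n n] index_diag_mult[of _ n n] del: index_mult_mat(1))
    then show ?thesis using that Wc(1) Sc by (simp add: frame_sum_eq SB)
  qed
  \<comment> \<open>The purification of \<open>S\<close> is \<open>Y = M * X\<close>, because
    \<open>M * X * (X * M) = S\<close>. Cyclicity turns its overlap with \<open>X\<close> into the
    trace of \<open>M * R\<close>.\<close>
  have "mtrace (adj X * (M * X)) = mtrace (M * X * adj X)"
    by (rule mtrace_comm) (use X Mh in auto)
  also have "M * X * adj X = W * (?D * adj W * R)"
    unfolding X(2) using XX X(1) Mh(1) W(2) Wc(1) Rc by (simp add: as)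
  also have "mtrace \<dots> = mtrace (?D * adj W * R * W)"
    by (rule mtrace_comm) (use Wc Rc in auto)
  also have "?D * adj W * R * W = ?D * B" unfolding B_def using Wc(1) Rc by (simp add: as)
  also have "Re (mtrace (?D * B)) = (\<Sum>i<n. m i * Re (B $$ (i,i)))"
    using Bc by (subst mtrace_carrier[of _ n]) (auto simp: index_diag_mult[of _ n n] simp del: index_mult_mat(1))
  also have "\<dots> = (\<Sum>i<n. sqrt (frame_sum n W {i} R * frame_sum n W {i} S))"
  proof (rule sum.cong[OF refl])
    fix i assume "i \<in> {..<n}"
    then have i: "i < n" by simp
    have "frame_sum n W {i} R * frame_sum n W {i} S = (m i * Re (B $$ (i,i)))\<^sup>2"
      unfolding pB[OF i] q[OF i] by (simp add: power2_eq_square)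
    moreover have "0 \<le> m i * Re (B $$ (i,i))" using W(3) i pos[OF W(1) i] pB[OF i] by simp
    ultimately show "m i * Re (B $$ (i,i)) = sqrt (frame_sum n W {i} R * frame_sum n W {i} S)" by simp
  qed
  finally have "Re (mtrace (adj X * (M * X))) = (\<Sum>i<n. sqrt (frame_sum n W {i} R * frame_sum n W {i} S))" .
  moreover have "M * X * adj (M * X) = S"
    using MXXM X Mh by (simp add: adj_mult[of _ n n _ n])
  moreover have "X * adj X = R" using XX X by simp
  ultimately show ?thesis using X(1) Mh(1) W(1) by (intro exI[of _ X] exI[of _ "M * X"] exI[of _ W]) simp
qed

subsection \<open>Tensor powers and the sample complexity\<close>

lemma cauchy_schwarz_cmod:
  fixes x y :: "'a \<Rightarrow> complex"
  assumes "finite T"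
  shows "cmod (\<Sum>i\<in>T. cnj (x i) * y i) \<le> sqrt (\<Sum>i\<in>T. (cmod (x i))\<^sup>2) * sqrt (\<Sum>i\<in>T. (cmod (y i))\<^sup>2)"
proof -
  have "cmod (\<Sum>i\<in>T. cnj (x i) * y i) \<le> (\<Sum>i\<in>T. \<bar>cmod (x i)\<bar> * \<bar>cmod (y i)\<bar>)"
    by (rule order_trans[OF norm_sum]) (simp add: norm_mult)
  also have "\<dots> \<le> L2_set (\<lambda>i. cmod (x i)) T * L2_set (\<lambda>i. cmod (y i)) T"
    by (rule L2_set_mult_ineq)
  finally show ?thesis by (simp add: L2_set_def)
qed

text \<open>With \<open>a\<close>, \<open>b\<close>, \<open>c\<close>, \<open>d\<close> the four
  square roots, \<open>(a * b + c * d)\<^sup>2 + (a * d - b * c)\<^sup>2 = 1\<close>. Moreover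
  \<open>p - q\<close> factors as \<open>(a * d - b * c) * (a * d + b * c)\<close>, whose second
  factor is at most 1.\<close>

lemma fidelity_bound_real:
  fixes p q :: real
  assumes "0 \<le> p" "p \<le> 1" "0 \<le> q" "q \<le> 1"
  shows "(sqrt p * sqrt q + sqrt (1 - p) * sqrt (1 - q))\<^sup>2 \<le> 1 - (p - q)\<^sup>2"
proof -
  define a b c d where "a = sqrt p" and "b = sqrt q" and "c = sqrt (1 - p)" and "d = sqrt (1 - q)"
  have sq: "a\<^sup>2 = p" "b\<^sup>2 = q" "c\<^sup>2 = 1 - p" "d\<^sup>2 = 1 - q" and nn: "0 \<le> a" "0 \<le> b" "0 \<le> c" "0 \<le> d"
    using assms by (simp_all add: a_def b_def c_def d_def)
  have "p - q = a\<^sup>2 * d\<^sup>2 - b\<^sup>2 * c\<^sup>2" unfolding sq by (simp add: algebra_simps)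
  also have "\<dots> = (a * d - b * c) * (a * d + b * c)" by (simp add: power2_eq_square algebra_simps)
  finally have 1: "(p - q)\<^sup>2 = (a * d - b * c)\<^sup>2 * (a * d + b * c)\<^sup>2" by (simp add: power_mult_distrib)
  have "0 \<le> (a - d)\<^sup>2 + (b - c)\<^sup>2" by simp
  then have "a * d + b * c \<le> 1" using sq by (simp add: power2_diff)
  then have "(a * d + b * c)\<^sup>2 \<le> 1" using nn by (simp add: power_le_one)
  then have "(p - q)\<^sup>2 \<le> (a * d - b * c)\<^sup>2" unfolding 1 by (simp add: mult_left_le)
  moreover have "(a * b + c * d)\<^sup>2 + (a * d - b * c)\<^sup>2 = (a\<^sup>2 + c\<^sup>2) * (b\<^sup>2 + d\<^sup>2)"
    by (simp add: power2_eq_square algebra_simps)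
  ultimately show ?thesis by (simp add: sq flip: a_def b_def c_def d_def)
qed

lemma index_adj_carrier:
  "A \<in> carrier_mat n m \<Longrightarrow> i < m \<Longrightarrow> j < n \<Longrightarrow> adj A $$ (i,j) = cnj (A $$ (j,i))"
  by auto

text \<open>Read \<open>X\<close> as a vector in a bipartite space whose purifying system has
  dimension \<open>m\<close>. The probability of the projection is then the squared norm of the rows
  of \<open>adj U * X\<close> that belong to \<open>S\<close>.\<close>

lemma frame_sum_square:
  assumes U: "U \<in> carrier_mat n n" and X: "X \<in> carrier_mat n m" and S: "S \<subseteq> {..<n}"
  shows "frame_sum n U S (X * adj X) = (\<Sum>(i,j)\<in>S \<times> {..<m}. (cmod ((adj U * X) $$ (i,j)))\<^sup>2)"
proof -
  let ?X = "adj U * X"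
  have Xc: "?X \<in> carrier_mat n m" using U X by (metis adj_carrier mult_carrier_mat)
  have "adj U * (X * adj X) * U = adj U * X * (adj X * U)"
    using U X by (simp add: assoc_mult_mat[of _ n n _ m _ n] assoc_mult_mat[of _ n m _ n _ n]
        assoc_mult_mat[of _ n n _ n _ n] mult_carrier_mat[of _ n m _ n] mult_carrier_mat[of _ m n _ n])
  then have e: "adj U * (X * adj X) * U = ?X * adj ?X"
    using U X by (simp add: adj_mult[of _ n n _ m])
  have "(?X * adj ?X) $$ (i,i) = complex_of_real (\<Sum>j<m. (cmod (?X $$ (i,j)))\<^sup>2)" if "i < n" for i
    unfolding of_real_sum complex_norm_square
    by (subst index_mult_sum[of _ n m _ n]) (use that Xc in \<open>auto simp: index_adj_carrier[OF Xc] simp del: index_mult_mat(1) index_adj intro!: sum.cong\<close>)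
  then have "frame_sum n U S (X * adj X) = (\<Sum>i\<in>S. \<Sum>j<m. (cmod (?X $$ (i,j)))\<^sup>2)"
    using U S X by (subst frame_sum_eq) (auto simp: e mult_carrier_mat[of _ n m _ n] simp del: index_mult_mat(1) intro!: sum.cong)
  then show ?thesis by (simp add: sum.cartesian_product)
qed

text \<open>Splitting the Hilbert-Schmidt inner product of the purifications \<open>X\<close>, \<open>Y\<close> along a two-outcome
  measurement; no optimality of the purifications is needed.\<close>

lemma fuchs_van_de_graaf:
  assumes X: "X \<in> carrier_mat n m" and Y: "Y \<in> carrier_mat n m" and U: "unitary_on n U" and S: "S \<subseteq> {..<n}"
    and tr: "mtrace (X * adj X) = 1" "mtrace (Y * adj Y) = 1"
  shows "(cmod (mtrace (adj X * Y)))\<^sup>2 \<le> 1 - (frame_sum n U S (X * adj X) - frame_sum n U S (Y * adj Y))\<^sup>2"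
proof -
  note Uc = unitary_onD[OF U]
  let ?X = "adj U * X" and ?Y = "adj U * Y"
  have c: "?X \<in> carrier_mat n m" "?Y \<in> carrier_mat n m" using Uc(1) X Y by (metis adj_carrier mult_carrier_mat)+
  have XX: "X * adj X \<in> carrier_mat n n" "Y * adj Y \<in> carrier_mat n n"
    using X Y by (metis adj_carrier mult_carrier_mat)+
  let ?p = "frame_sum n U S (X * adj X)" and ?q = "frame_sum n U S (Y * adj Y)"
  let ?S' = "{..<n} - S"
  let ?g = "\<lambda>(i,j). cnj (?X $$ (i,j)) * ?Y $$ (i,j)"
  have "mtrace (adj X * Y) = mtrace (Y * adj X)"
    by (rule mtrace_comm) (use X Y in auto)
  also have "\<dots> = mtrace (adj U * (Y * adj X) * U)"
    using mtrace_conj_unitary[OF unitary_on_adj[OF U], of "Y * adj X"] X Y by (simp add: mult_carrier_mat[of _ n m _ n])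
  also have "adj U * (Y * adj X) * U = ?Y * adj ?X"
    using Uc(1) X Y by (simp add: adj_mult[of _ n n _ m] assoc_mult_mat[of _ n n _ m _ n] assoc_mult_mat[of _ n m _ n _ n]
        assoc_mult_mat[of _ n n _ n _ n] mult_carrier_mat[of _ n m _ n] mult_carrier_mat[of _ m n _ n])
  also have "mtrace (?Y * adj ?X) = (\<Sum>i<n. \<Sum>j<m. cnj (?X $$ (i,j)) * ?Y $$ (i,j))"
  proof (subst mtrace_carrier[of _ n])
    show "?Y * adj ?X \<in> carrier_mat n n" using c by (metis adj_carrier mult_carrier_mat)
    show "(\<Sum>i<n. (?Y * adj ?X) $$ (i,i)) = (\<Sum>i<n. \<Sum>j<m. cnj (?X $$ (i,j)) * ?Y $$ (i,j))"
    proof (rule sum.cong[OF refl])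
      fix i assume "i \<in> {..<n}"
      then show "(?Y * adj ?X) $$ (i,i) = (\<Sum>j<m. cnj (?X $$ (i,j)) * ?Y $$ (i,j))"
        by (subst index_mult_sum[OF c(2) adj_carrier[OF c(1)]])
          (use c in \<open>auto simp: mult.commute index_adj_carrier[OF c(1)] simp del: index_mult_mat(1) index_adj intro!: sum.cong\<close>)
    qed
  qed
  also have "\<dots> = sum ?g ({..<n} \<times> {..<m})" by (simp add: sum.cartesian_product)
  \<comment> \<open>The rows inside and outside \<open>S\<close> carry the two outcomes.
    Cauchy-Schwarz on each block bounds the overlap by the fidelity of the two binary
    distributions.\<close>
  also have "{..<n} \<times> {..<m} = S \<times> {..<m} \<union> ?S' \<times> {..<m}" using S by auto
  also have "sum ?g \<dots> = sum ?g (S \<times> {..<m}) + sum ?g (?S' \<times> {..<m})"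
    by (rule sum.union_disjoint) (use S in \<open>auto intro: finite_subset\<close>)
  finally have t: "mtrace (adj X * Y) = sum ?g (S \<times> {..<m}) + sum ?g (?S' \<times> {..<m})" .
  have CS: "cmod (sum ?g (T \<times> {..<m})) \<le> sqrt (frame_sum n U T (X * adj X)) * sqrt (frame_sum n U T (Y * adj Y))"
    if T: "T \<subseteq> {..<n}" for T
    using cauchy_schwarz_cmod[of "T \<times> {..<m}" "\<lambda>ij. ?X $$ ij" "\<lambda>ij. ?Y $$ ij"] finite_subset[OF T]
    by (simp add: frame_sum_square[OF Uc(1) X T] frame_sum_square[OF Uc(1) Y T] case_prod_beta' del: index_mult_mat)
  have nn: "0 \<le> frame_sum n U T (X * adj X)" "0 \<le> frame_sum n U T (Y * adj Y)" if T: "T \<subseteq> {..<n}" for T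
    by (auto simp: frame_sum_square[OF Uc(1) X T] frame_sum_square[OF Uc(1) Y T] simp del: index_mult_mat intro!: sum_nonneg)
  have c1: "frame_sum n U ?S' (X * adj X) = 1 - ?p" "frame_sum n U ?S' (Y * adj Y) = 1 - ?q"
    using tr by (simp_all add: frame_sum_compl[OF U XX(1) S] frame_sum_compl[OF U XX(2) S])
  have "cmod (mtrace (adj X * Y)) \<le> sqrt ?p * sqrt ?q + sqrt (1 - ?p) * sqrt (1 - ?q)"
    unfolding t using CS[OF S] CS[of ?S'] by (intro order_trans[OF norm_triangle_ineq] add_mono) (auto simp: c1)
  then have "(cmod (mtrace (adj X * Y)))\<^sup>2 \<le> (sqrt ?p * sqrt ?q + sqrt (1 - ?p) * sqrt (1 - ?q))\<^sup>2"
    by (rule power_mono) simp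
  also have "\<dots> \<le> 1 - (?p - ?q)\<^sup>2"
    by (rule fidelity_bound_real) (use nn[OF S] nn[of ?S'] c1 in auto)
  finally show ?thesis .
qed

section \<open>Kronecker products and tensor powers\<close>

lemma kron_carrier [simp]:
  "A \<in> carrier_mat a b \<Longrightarrow> B \<in> carrier_mat c d \<Longrightarrow> kron A B \<in> carrier_mat (a * c) (b * d)"
  by (auto simp: kron_def)

lemma index_kron:
  "A \<in> carrier_mat a b \<Longrightarrow> B \<in> carrier_mat c d \<Longrightarrow> i < a * c \<Longrightarrow> j < b * d \<Longrightarrow>
    kron A B $$ (i,j) = A $$ (i div c, j div d) * B $$ (i mod c, j mod d)"
  by (auto simp: kron_def)

lemma div_mod_less_mult:
  fixes i :: nat
  assumes "i < a * b"
  shows "i div b < a" "i mod b < b"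
proof -
  have "b > 0" using assms by (cases b) auto
  then show "i div b < a" "i mod b < b" using assms by (auto simp: less_mult_imp_div_less)
qed

text \<open>Quotient and remainder turn an index of a Kronecker product into the pair of indices of
  its factors.\<close>

lemma sum_div_mod:
  fixes g :: "nat \<Rightarrow> nat \<Rightarrow> 'a::comm_monoid_add"
  shows "(\<Sum>l<a*b. g (l div b) (l mod b)) = (\<Sum>x<a. \<Sum>y<b. g x y)"
proof -
  have "bij_betw (\<lambda>l. (l div b, l mod b)) {..<a*b} ({..<a} \<times> {..<b})"
  proof (rule bij_betw_byWitness[where f' = "\<lambda>(x,y). x * b + y"])
    show "(\<lambda>(x,y). x * b + y) ` ({..<a} \<times> {..<b}) \<subseteq> {..<a*b}"
    proof clarsimp
      fix x y assume "x < a" "y < b"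
      then have "x * b + y < Suc x * b" by simp
      also have "\<dots> \<le> a * b" using \<open>x < a\<close> by (intro mult_right_mono) auto
      finally show "x * b + y < a * b" .
    qed
  qed (auto simp: div_mod_less_mult)
  from sum.reindex_bij_betw[OF this, of "\<lambda>(x,y). g x y"]
  show ?thesis by (simp add: sum.cartesian_product)
qed

text \<open>The mixed-product rule: the summation index splits by \<open>sum_div_mod\<close>, and
  the double sum then factors.\<close>

lemma kron_mult:
  assumes A: "A \<in> carrier_mat a b" and B: "B \<in> carrier_mat a' b'"
    and C: "C \<in> carrier_mat b c" and D: "D \<in> carrier_mat b' c'"
  shows "kron A B * kron C D = kron (A * C) (B * D)"
proof (rule eq_matI)
  have AC: "A * C \<in> carrier_mat a c" and BD: "B * D \<in> carrier_mat a' c'" using assms by auto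
  fix i j assume "i < dim_row (kron (A * C) (B * D))" "j < dim_col (kron (A * C) (B * D))"
  then have ij: "i < a * a'" "j < c * c'" using assms by (auto simp: kron_def)
  note dm = div_mod_less_mult[OF ij(1)] div_mod_less_mult[OF ij(2)]
  have "(kron A B * kron C D) $$ (i,j) = (\<Sum>l<b*b'. kron A B $$ (i,l) * kron C D $$ (l,j))"
    by (rule index_mult_sum[OF kron_carrier[OF A B] kron_carrier[OF C D] ij])
  also have "\<dots> = (\<Sum>l<b*b'. (A $$ (i div a', l div b') * B $$ (i mod a', l mod b'))
      * (C $$ (l div b', j div c') * D $$ (l mod b', j mod c')))"
    by (rule sum.cong) (auto simp: index_kron[OF A B] index_kron[OF C D] ij)
  also have "\<dots> = (\<Sum>x<b. \<Sum>y<b'. (A $$ (i div a', x) * B $$ (i mod a', y)) * (C $$ (x, j div c') * D $$ (y, j mod c')))"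
    by (rule sum_div_mod)
  also have "\<dots> = (\<Sum>x<b. A $$ (i div a', x) * C $$ (x, j div c')) * (\<Sum>y<b'. B $$ (i mod a', y) * D $$ (y, j mod c'))"
    by (simp add: sum_product mult_ac)
  also have "\<dots> = (A * C) $$ (i div a', j div c') * (B * D) $$ (i mod a', j mod c')"
    using index_mult_sum[OF A C dm(1,3)] index_mult_sum[OF B D dm(2,4)] by simp
  finally show "(kron A B * kron C D) $$ (i,j) = kron (A * C) (B * D) $$ (i,j)"
    by (simp only: index_kron[OF AC BD ij])
qed (use assms in \<open>auto simp: kron_def\<close>)

lemma adj_kron:
  assumes A: "A \<in> carrier_mat a b" and B: "B \<in> carrier_mat c d"
  shows "adj (kron A B) = kron (adj A) (adj B)"
proof (rule eq_matI)
  fix i j assume "i < dim_row (kron (adj A) (adj B))" "j < dim_col (kron (adj A) (adj B))"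
  then have ij: "i < b * d" "j < a * c" using assms by (auto simp: kron_def)
  have "adj (kron A B) $$ (i,j) = cnj (kron A B $$ (j,i))"
    using kron_carrier[OF A B] ij by simp
  then show "adj (kron A B) $$ (i,j) = kron (adj A) (adj B) $$ (i,j)"
    using ij div_mod_less_mult[OF ij(1)] div_mod_less_mult[OF ij(2)] A B
    by (simp add: index_kron[OF A B] index_kron[OF adj_carrier[OF A] adj_carrier[OF B]])
qed (use assms in \<open>auto simp: kron_def\<close>)

lemma mtrace_kron:
  assumes A: "A \<in> carrier_mat a a" and B: "B \<in> carrier_mat b b"
  shows "mtrace (kron A B) = mtrace A * mtrace B"
proof -
  have "mtrace (kron A B) = (\<Sum>l<a*b. A $$ (l div b, l div b) * B $$ (l mod b, l mod b))"
    by (subst mtrace_carrier[OF kron_carrier[OF A B]]) (rule sum.cong, auto simp: index_kron[OF A B])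
  also have "\<dots> = (\<Sum>x<a. \<Sum>y<b. A $$ (x,x) * B $$ (y,y))" by (rule sum_div_mod)
  finally show ?thesis by (simp add: mtrace_carrier[OF A] mtrace_carrier[OF B] sum_product)
qed

lemma tpow_carrier [simp]: "A \<in> carrier_mat d d \<Longrightarrow> tpow A n \<in> carrier_mat (d ^ n) (d ^ n)"
  by (induction n) auto

lemma tpow_mult:
  assumes "A \<in> carrier_mat d d" "B \<in> carrier_mat d d"
  shows "tpow A n * tpow B n = tpow (A * B) n"
proof (induction n)
  case (Suc n)
  then show ?case
    using kron_mult[OF assms(1) tpow_carrier[OF assms(1)] assms(2) tpow_carrier[OF assms(2)]] by simp
qed simp

lemma adj_tpow: "A \<in> carrier_mat d d \<Longrightarrow> adj (tpow A n) = tpow (adj A) n"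
  by (induction n) (auto simp: adj_kron[OF _ tpow_carrier])

text \<open>Applied to \<open>adj X * Y\<close>, and combined with \<open>tpow_mult\<close> and
  \<open>adj_tpow\<close>, this makes overlaps of purifications multiplicative in the number of
  copies.\<close>

lemma mtrace_tpow:
  assumes "A \<in> carrier_mat d d"
  shows "mtrace (tpow A n) = mtrace A ^ n"
proof (induction n)
  case 0 then show ?case by (simp add: mtrace_def)
qed (use assms in \<open>simp add: mtrace_kron[OF assms tpow_carrier]\<close>)

lemma hermitian_on_tpow:
  assumes "hermitian_on d A"
  shows "hermitian_on (d ^ n) (tpow A n)"
  using hermitian_onD(1,2)[OF assms] by (simp add: hermitian_on_def adj_tpow)

text \<open>Every entry of a tensor power is a product of entries of the factors. For fixed
  \<open>U\<close> and \<open>S\<close> a frame sum is linear in the entries, so entrywise limits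
  suffice to remove the depolarization.\<close>

lemma tendsto_tpow:
  assumes A: "\<And>m. A m \<in> carrier_mat d d" "A' \<in> carrier_mat d d"
    and lim: "\<And>i j. i < d \<Longrightarrow> j < d \<Longrightarrow> ((\<lambda>m. A m $$ (i,j)) \<longlongrightarrow> A' $$ (i,j)) F"
  shows "i < d ^ n \<Longrightarrow> j < d ^ n \<Longrightarrow> ((\<lambda>m. tpow (A m) n $$ (i,j)) \<longlongrightarrow> tpow A' n $$ (i,j)) F"
proof (induction n arbitrary: i j)
  case (Suc n)
  then have ij: "i < d * d ^ n" "j < d * d ^ n" by auto
  note dm = div_mod_less_mult[OF ij(1)] div_mod_less_mult[OF ij(2)]
  show ?case
    unfolding tpow.simps index_kron[OF A(1) tpow_carrier[OF A(1)] ij] index_kron[OF A(2) tpow_carrier[OF A(2)] ij]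
    by (intro tendsto_mult lim Suc.IH dm)
qed simp

lemma tendsto_frame_sum:
  assumes "\<And>i j. i < n \<Longrightarrow> j < n \<Longrightarrow> ((\<lambda>m. A m $$ (i,j)) \<longlongrightarrow> A' $$ (i,j)) F"
  shows "((\<lambda>m. frame_sum n U S (A m)) \<longlongrightarrow> frame_sum n U S A') F"
  unfolding frame_sum_def by (intro tendsto_sum tendsto_Re tendsto_mult tendsto_const assms) auto

section \<open>Depolarization and the error bound for many copies\<close>

text \<open>Mixture with the maximally mixed state of weight \<delta>. For \<delta> strictly between
  0 and 1 it makes states positive definite, as \<open>fuchs_caves\<close> requires.\<close>

definition depolarize :: "nat \<Rightarrow> real \<Rightarrow> complex mat \<Rightarrow> complex mat" where
  "depolarize d \<delta> A = mat d d (\<lambda>(i,j). complex_of_real (1 - \<delta>) * A $$ (i,j) + (if i = j then complex_of_real (\<delta> / d) else 0))"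

lemma frame_sum_depolarize:
  assumes U: "unitary_on d U" and S: "S \<subseteq> {..<d}" and A: "A \<in> carrier_mat d d"
  shows "frame_sum d U S (depolarize d \<delta> A) = (1 - \<delta>) * frame_sum d U S A + \<delta> / d * card S"
proof -
  \<comment> \<open>The identity is added as the subtraction of a negative multiple, to fit the form
    of \<open>frame_sum_diff\<close>.\<close>
  have e: "depolarize d \<delta> A = complex_of_real (1 - \<delta>) \<cdot>\<^sub>m A - complex_of_real (- (\<delta> / d)) \<cdot>\<^sub>m 1\<^sub>m d"
    using A by (intro eq_matI) (auto simp: depolarize_def)
  have "frame_sum d U S (1\<^sub>m d) = (\<Sum>i\<in>S. Re (1\<^sub>m d $$ (i,i)))"
    using unitary_onD[OF U] S by (subst frame_sum_eq) auto
  also have "\<dots> = (\<Sum>i\<in>S. 1)" by (rule sum.cong) (use S in auto)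
  finally have "frame_sum d U S (1\<^sub>m d) = card S" by simp
  then show ?thesis
    unfolding e using A
    by (subst frame_sum_diff, simp, simp) (simp only: frame_sum_smult minus_mult_left diff_minus_eq_add)
qed

lemma density_depolarize:
  assumes "density d A" "0 \<le> \<delta>" "\<delta> \<le> 1"
  shows "density d (depolarize d \<delta> A)"
proof -
  note A = densityD[OF assms(1)]
  have d: "d > 0" using A(3,4) by (cases d) (auto simp: mtrace_def)
  have e: "depolarize d \<delta> A = complex_of_real (1 - \<delta>) \<cdot>\<^sub>m A - complex_of_real (- (\<delta> / d)) \<cdot>\<^sub>m 1\<^sub>m d"
    using A(3) by (intro eq_matI) (auto simp: depolarize_def)
  have h: "hermitian_on d (depolarize d \<delta> A)"
    unfolding e
    by (intro hermitian_on_diff psd_on_hermitian[OF psd_on_smult[OF A(1)]]) (use assms in \<open>auto simp: hermitian_on_def\<close>)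
  obtain U f where U: "unitary_on d U" "depolarize d \<delta> A = U * diag_real d f * adj U"
    using spectral_decomposition[OF h] by blast
  have "f i \<ge> 0" if "i < d" for i
  proof -
    have "0 \<le> (1 - \<delta>) * frame_sum d U {i} A" "0 \<le> \<delta> / d"
      using frame_sum_nonneg[OF A(1)] assms by simp_all
    then show ?thesis
      using frame_sum_spectral_single[OF U(1) that, of f] frame_sum_depolarize[OF U(1) _ A(3), of "{i}" \<delta>]
        that unfolding U(2) by simp
  qed
  then have "psd_on d (depolarize d \<delta> A)" unfolding U(2) by (intro psd_on_spectral[OF U(1)])
  moreover have "mtrace (depolarize d \<delta> A) = 1"
    unfolding e using A(3,4) d
    by (subst mtrace_minus[of _ d]) (simp_all add: mtrace_smult[of _ d] mtrace_carrier[of "1\<^sub>m d" d])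
  ultimately show ?thesis by (simp add: density_def)
qed

text \<open>The maximally mixed parts contribute \<open>(1 - \<gamma>) * c\<close>, which is
  nonpositive for \<open>\<gamma> \<ge> 1\<close>. The remaining factor \<open>1 - \<delta>\<close>
  is at most 1 and multiplies a nonnegative divergence.\<close>

lemma E_hs_depolarize_le:
  assumes \<rho>: "density d \<rho>" and \<sigma>: "density d \<sigma>" and \<delta>: "0 \<le> \<delta>" "\<delta> \<le> 1" and g: "\<gamma> \<ge> 1"
  shows "E_hs \<gamma> (depolarize d \<delta> \<rho>) (depolarize d \<delta> \<sigma>) \<le> E_hs \<gamma> \<rho> \<sigma>"
proof -
  note r = densityD[OF \<rho>] and s = densityD[OF \<sigma>]
  obtain U S where U: "unitary_on d U" "S \<subseteq> {..<d}"
      and E: "E_hs \<gamma> (depolarize d \<delta> \<rho>) (depolarize d \<delta> \<sigma>)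
        = frame_sum d U S (depolarize d \<delta> \<rho>) - \<gamma> * frame_sum d U S (depolarize d \<delta> \<sigma>)"
    using E_hs_attained[OF densityD(2)[OF density_depolarize[OF \<rho> \<delta>]] densityD(2)[OF density_depolarize[OF \<sigma> \<delta>]]]
    by blast
  define c where "c = \<delta> / d * card S"
  have "0 \<le> (\<gamma> - 1) * c" using \<delta> g by (simp add: c_def)
  then have "E_hs \<gamma> (depolarize d \<delta> \<rho>) (depolarize d \<delta> \<sigma>)
      \<le> (1 - \<delta>) * (frame_sum d U S \<rho> - \<gamma> * frame_sum d U S \<sigma>)"
    unfolding E frame_sum_depolarize[OF U r(3)] frame_sum_depolarize[OF U s(3)] c_def[symmetric]
    by (simp add: algebra_simps)
  also have "\<dots> \<le> (1 - \<delta>) * E_hs \<gamma> \<rho> \<sigma>"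
    using E_hs_ge_frame_sum[OF r(2) s(2) U] \<delta> by (intro mult_left_mono) auto
  also have "\<dots> \<le> E_hs \<gamma> \<rho> \<sigma>"
    using E_hs_nonneg[OF r(2) s(2), of \<gamma>] \<delta> by (intro mult_left_le_one_le) auto
  finally show ?thesis .
qed

lemma H_half_depolarize_le:
  assumes "density d \<rho>" "density d \<sigma>" "0 \<le> \<delta>" "\<delta> \<le> 1"
  shows "H_half (depolarize d \<delta> \<rho>) (depolarize d \<delta> \<sigma>) \<le> H_half \<rho> \<sigma>"
  using H_half_mono[of d \<rho> \<sigma> d "depolarize d \<delta> \<rho>" "depolarize d \<delta> \<sigma>" 1]
    density_depolarize E_hs_depolarize_le assms by simp

text \<open>One copy has Fuchs-Caves purifications with overlap at least
  \<open>1 - H_half \<rho> \<sigma> / 2\<close>, so \<open>n\<close> copies have at least its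
  \<open>n\<close>-th power, and \<open>fuchs_van_de_graaf\<close> compares this with any
  projection. The bound \<open>H\<close> keeps the base nonnegative, so that powers are
  monotone.\<close>

lemma depolarized_tpow_bound:
  assumes \<rho>: "density d \<rho>" and \<sigma>: "density d \<sigma>" and \<delta>: "0 < \<delta>" "\<delta> < 1" and H: "H_half \<rho> \<sigma> \<le> 2"
    and U: "unitary_on (d ^ n) U" "S \<subseteq> {..<d ^ n}"
  shows "(1 - H_half \<rho> \<sigma> / 2) ^ (2 * n) \<le>
    1 - (frame_sum (d ^ n) U S (tpow (depolarize d \<delta> \<rho>) n) - frame_sum (d ^ n) U S (tpow (depolarize d \<delta> \<sigma>) n))\<^sup>2"
proof -
  let ?R = "depolarize d \<delta> \<rho>" and ?S = "depolarize d \<delta> \<sigma>"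
  have R: "density d ?R" and S: "density d ?S" using density_depolarize \<rho> \<sigma> \<delta> by auto
  have pos: "frame_sum d V {i} (depolarize d \<delta> A) > 0" if "density d A" "unitary_on d V" "i < d" for V i A
  proof -
    have "0 \<le> (1 - \<delta>) * frame_sum d V {i} A"
      using frame_sum_nonneg[OF densityD(1)[OF that(1)]] \<delta> by simp
    moreover have "0 < \<delta> / d" using \<delta> that by simp
    ultimately show ?thesis
      using frame_sum_depolarize[OF that(2) _ densityD(3)[OF that(1)], of "{i}" \<delta>] that(3) by simp
  qed
  obtain X Y W where X: "X \<in> carrier_mat d d" "Y \<in> carrier_mat d d" "unitary_on d W"
      "X * adj X = ?R" "Y * adj Y = ?S"
      and f: "Re (mtrace (adj X * Y)) = (\<Sum>i<d. sqrt (frame_sum d W {i} ?R * frame_sum d W {i} ?S))"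
    using fuchs_caves[OF densityD(2)[OF R] densityD(1)[OF S] pos[OF \<rho>]] by blast
  \<comment> \<open>Passing back to the original states makes the left side independent of \<delta>,
    ready for the limit.\<close>
  have "1 - H_half \<rho> \<sigma> / 2 \<le> 1 - H_half ?R ?S / 2"
    using H_half_depolarize_le[OF \<rho> \<sigma>, of \<delta>] \<delta> by simp
  also have "\<dots> \<le> Re (mtrace (adj X * Y))"
    unfolding f by (rule H_half_ge_measured[OF R S X(3) pos[OF \<rho> X(3)] pos[OF \<sigma> X(3)]])
  also have "\<dots> \<le> cmod (mtrace (adj X * Y))" by (rule complex_Re_le_cmod)
  finally have "(1 - H_half \<rho> \<sigma> / 2) ^ (2 * n) \<le> cmod (mtrace (adj X * Y)) ^ (2 * n)"
    using H by (intro power_mono) auto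
  also have "\<dots> = (cmod (mtrace (adj (tpow X n) * tpow Y n)))\<^sup>2"
    using X(1,2) by (simp add: adj_tpow tpow_mult[of _ d] mtrace_tpow[of _ d] norm_power mult.commute flip: power_mult)
  also have "\<dots> \<le> 1 - (frame_sum (d ^ n) U S (tpow X n * adj (tpow X n)) - frame_sum (d ^ n) U S (tpow Y n * adj (tpow Y n)))\<^sup>2"
  proof (rule fuchs_van_de_graaf[OF tpow_carrier[OF X(1)] tpow_carrier[OF X(2)] U])
    show "mtrace (tpow X n * adj (tpow X n)) = 1" "mtrace (tpow Y n * adj (tpow Y n)) = 1"
      using X densityD(3,4)[OF R] densityD(3,4)[OF S]
      by (simp_all add: adj_tpow tpow_mult[of _ d] mtrace_tpow[of _ d])
  qed
  finally show ?thesis using X by (simp add: adj_tpow tpow_mult[of _ d])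
qed

text \<open>The optimal projection is chosen for the original tensor powers and kept fixed while
  \<delta> tends to 0. Only frame sums have to converge, so continuity of \<open>E_hs\<close> does
  not enter.\<close>

lemma E_hs_tpow_bound:
  assumes \<rho>: "density d \<rho>" and \<sigma>: "density d \<sigma>" and H: "H_half \<rho> \<sigma> \<le> 2"
  shows "(1 - H_half \<rho> \<sigma> / 2) ^ (2 * n) \<le> 1 - (E_hs 1 (tpow \<rho> n) (tpow \<sigma> n))\<^sup>2"
proof -
  obtain U S where U: "unitary_on (d ^ n) U" "S \<subseteq> {..<d ^ n}"
      and E: "E_hs 1 (tpow \<rho> n) (tpow \<sigma> n) = frame_sum (d ^ n) U S (tpow \<rho> n) - 1 * frame_sum (d ^ n) U S (tpow \<sigma> n)"
    using E_hs_attained[OF hermitian_on_tpow hermitian_on_tpow] densityD(2) \<rho> \<sigma> by metis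
  have lim: "((\<lambda>\<delta>. frame_sum (d ^ n) U S (tpow (depolarize d \<delta> A) n)) \<longlongrightarrow> frame_sum (d ^ n) U S (tpow A n)) (at_right 0)"
    if A: "density d A" for A
  proof (intro tendsto_frame_sum tendsto_tpow[where d = d])
    fix i j assume ij: "i < d" "j < d"
    have "((\<lambda>\<delta>. complex_of_real (1 - \<delta>) * A $$ (i,j) + (if i = j then complex_of_real (\<delta> / d) else 0))
        \<longlongrightarrow> complex_of_real (1 - 0) * A $$ (i,j) + (if i = j then complex_of_real (0 / d) else 0)) (at_right 0)"
      using ij by (cases "i = j") (auto intro!: tendsto_eq_intros)
    then show "((\<lambda>\<delta>. depolarize d \<delta> A $$ (i,j)) \<longlongrightarrow> A $$ (i,j)) (at_right 0)"
      using ij by (simp add: depolarize_def split: if_splits)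
  qed (use densityD(3)[OF A] in \<open>auto simp: depolarize_def\<close>)
  have "((\<lambda>\<delta>. 1 - (frame_sum (d ^ n) U S (tpow (depolarize d \<delta> \<rho>) n) - frame_sum (d ^ n) U S (tpow (depolarize d \<delta> \<sigma>) n))\<^sup>2)
      \<longlongrightarrow> 1 - (frame_sum (d ^ n) U S (tpow \<rho> n) - frame_sum (d ^ n) U S (tpow \<sigma> n))\<^sup>2) (at_right 0)"
    by (intro tendsto_intros lim \<rho> \<sigma>)
  moreover have "eventually (\<lambda>\<delta>. \<delta> \<in> {0<..<1::real}) (at_right 0)"
    by (rule eventually_at_right_real) simp
  then have "eventually (\<lambda>\<delta>. (1 - H_half \<rho> \<sigma> / 2) ^ (2 * n) \<le>
      1 - (frame_sum (d ^ n) U S (tpow (depolarize d \<delta> \<rho>) n) - frame_sum (d ^ n) U S (tpow (depolarize d \<delta> \<sigma>) n))\<^sup>2) (at_right 0)"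
    by (rule eventually_mono) (auto intro!: depolarized_tpow_bound[OF \<rho> \<sigma> _ _ H U])
  ultimately show ?thesis
    unfolding E mult_1 by (rule tendsto_lowerbound) simp
qed

section \<open>Sample complexity\<close>

text \<open>The number \<open>h\<close> is any upper bound of \<open>H_half\<close>; for a private
  channel it will be the contracted value of the input states.\<close>

lemma sample_size_bound:
  assumes \<rho>: "density d \<rho>" and \<sigma>: "density d \<sigma>" and n: "n \<ge> 1" and h: "H_half \<rho> \<sigma> \<le> h"
    and err: "p_err (tpow \<rho> n) (tpow \<sigma> n) (1/2) \<le> 1/10"
  shows "ln (5/2) \<le> 2 * n * h"
proof (cases "h \<le> 1")
  case True
  have h0: "0 \<le> h" using H_half_nonneg[OF \<rho> \<sigma>] h by simp
  \<comment> \<open>With equal priors the threshold \<open>(1 - p) / p\<close> is 1 and the error is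
    half of \<open>1 - E_hs 1\<close>, so an error of at most 1/10 forces the value 4/5.\<close>
  have "E_hs 1 (tpow \<rho> n) (tpow \<sigma> n) \<ge> 4/5" using err by (simp add: p_err_def)
  then have "(E_hs 1 (tpow \<rho> n) (tpow \<sigma> n))\<^sup>2 \<ge> (4/5)\<^sup>2" by (intro power_mono) auto
  moreover have "(1 - h / 2) ^ (2 * n) \<le> (1 - H_half \<rho> \<sigma> / 2) ^ (2 * n)"
    using h True by (intro power_mono) auto
  \<comment> \<open>The exact value \<open>1 - (4/5)\<^sup>2\<close> is 9/25, which is below
    2/5.\<close>
  ultimately have "(1 - h / 2) ^ (2 * n) \<le> 2/5"
    using E_hs_tpow_bound[OF \<rho> \<sigma>, of n] h True by (simp add: power2_eq_square)
  moreover have pos: "0 < 1 - h / 2" using True by simp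
  ultimately have "ln ((1 - h / 2) ^ (2 * n)) \<le> ln (2/5)" by (subst ln_le_cancel_iff) auto
  moreover have "ln (2/5 :: real) = - ln (5/2)" using ln_inverse[of "5/2 :: real"] by simp
  ultimately have 1: "2 * real n * ln (1 - h / 2) \<le> - ln (5/2)" using pos by (simp add: ln_realpow)
  \<comment> \<open>For \<open>x = h / 2\<close> at most 1/2 the quadratic term
    \<open>2 * x\<^sup>2\<close> is at most \<open>x\<close>, so the logarithm is at least
    \<open>- 2 * x = - h\<close>.\<close>
  have "- (h / 2) - 2 * (h / 2)\<^sup>2 \<le> ln (1 - h / 2)"
    by (rule ln_one_minus_pos_lower_bound) (use True h0 in auto)
  moreover have "(h / 2)\<^sup>2 \<le> h / 2 * (1/2)"
    unfolding power2_eq_square using True h0 by (intro mult_left_mono) auto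
  ultimately have "- h \<le> ln (1 - h / 2)" by simp
  then have "2 * real n * (- h) \<le> 2 * real n * ln (1 - h / 2)" by (intro mult_left_mono) auto
  then show ?thesis using 1 by linarith
next
  case False
  \<comment> \<open>For \<open>h > 1\<close> a single copy already suffices for the claim:
    \<open>ln (5/2)\<close> is at most 3/2, while \<open>2 * n * h\<close> exceeds 2.\<close>
  have "ln (5/2 :: real) \<le> 5/2 - 1" by (rule ln_le_minus_one) simp
  moreover have "1 * 1 \<le> real n * h" using False n by (intro mult_mono) auto
  ultimately show ?thesis by simp
qed

text \<open>Each admissible \<open>n\<close> satisfies \<open>sample_size_bound\<close>. For
  \<open>h = 0\<close> this would force \<open>ln (5/2) \<le> 0\<close>, so no \<open>n\<close> is
  admissible and the infimum of the empty set is infinite, matching the convention for division by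
  zero.\<close>

lemma nB_lower_bound:
  assumes \<rho>: "density d \<rho>" and \<sigma>: "density d \<sigma>" and h: "H_half \<rho> \<sigma> \<le> h"
  shows "(if h = 0 then \<infinity> else ereal (ln (5/2) / (2 * h))) \<le> nB \<rho> \<sigma> (1/2) (1/10)"
  unfolding nB_def
proof (rule Inf_greatest, clarify)
  fix n :: nat assume n: "n \<ge> 1" "p_err (tpow \<rho> n) (tpow \<sigma> n) (1/2) \<le> 1/10"
  have b: "ln (5/2) \<le> 2 * n * h" by (rule sample_size_bound[OF \<rho> \<sigma> n(1) h n(2)])
  have "ln (5/2 :: real) > 0" by simp
  then have "h \<noteq> 0" using b by auto
  moreover have "0 \<le> h" using H_half_nonneg[OF \<rho> \<sigma>] h by simp
  ultimately show "(if h = 0 then \<infinity> else ereal (ln (5/2) / (2 * h))) \<le> ereal (real n)"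
    using b by (simp add: pos_divide_le_eq mult_ac)
qed

theorem mainTheorem3:
  fixes \<epsilon> :: real and d :: nat and \<rho> \<sigma> :: "complex mat"
  assumes "\<epsilon> > 0" and "density d \<rho>" and "density d \<sigma>"
  shows "(SUP (dB, \<Phi>) \<in> {(dB, \<Phi>). LDP \<epsilon> d dB \<Phi>}. ereal (H_half (\<Phi> \<rho>) (\<Phi> \<sigma>)))
           \<le> ereal ((exp \<epsilon> - 1) / (exp \<epsilon> + 1) * H_half \<rho> \<sigma>)
         \<and> nB_eps \<epsilon> d \<rho> \<sigma> (1/2) (1/10) \<ge>
           (if H_half \<rho> \<sigma> = 0 then \<infinity>
            else ereal ((exp \<epsilon> + 1) * ln (5/2) / (2 * (exp \<epsilon> - 1) * H_half \<rho> \<sigma>)))"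
proof
  show "(SUP (dB, \<Phi>) \<in> {(dB, \<Phi>). LDP \<epsilon> d dB \<Phi>}. ereal (H_half (\<Phi> \<rho>) (\<Phi> \<sigma>)))
      \<le> ereal ((exp \<epsilon> - 1) / (exp \<epsilon> + 1) * H_half \<rho> \<sigma>)"
    using H_half_LDP_le assms(2,3) by (auto intro!: SUP_least)
  let ?h = "(exp \<epsilon> - 1) / (exp \<epsilon> + 1) * H_half \<rho> \<sigma>"
  have e: "exp \<epsilon> > 1" using assms(1) by simp
  \<comment> \<open>As \<epsilon> is positive, the contraction coefficient is nonzero. Hence
    \<open>?h\<close> vanishes exactly when \<open>H_half \<rho> \<sigma>\<close> does, and both
    branches agree.\<close>
  have "(if H_half \<rho> \<sigma> = 0 then \<infinity>
         else ereal ((exp \<epsilon> + 1) * ln (5/2) / (2 * (exp \<epsilon> - 1) * H_half \<rho> \<sigma>)))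
      = (if ?h = 0 then \<infinity> else ereal (ln (5/2) / (2 * ?h)))"
    using e add_pos_pos[of "exp \<epsilon>" 1] by (simp add: mult_ac)
  also have "\<dots> \<le> nB_eps \<epsilon> d \<rho> \<sigma> (1/2) (1/10)"
    unfolding nB_eps_def
  proof (rule INF_greatest, clarify)
    fix dB \<Phi> assume L: "LDP \<epsilon> d dB \<Phi>"
    then have ch: "channel d dB \<Phi>" by (simp add: LDP_def)
    show "(if ?h = 0 then \<infinity> else ereal (ln (5/2) / (2 * ?h))) \<le> nB (\<Phi> \<rho>) (\<Phi> \<sigma>) (1/2) (1/10)"
      by (rule nB_lower_bound[OF channel_density[OF ch assms(2)] channel_density[OF ch assms(3)]
            H_half_LDP_le[OF L assms(2,3)]])
  qed
  finally show "(if H_half \<rho> \<sigma> = 0 then \<infinity>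
         else ereal ((exp \<epsilon> + 1) * ln (5/2) / (2 * (exp \<epsilon> - 1) * H_half \<rho> \<sigma>)))
      \<le> nB_eps \<epsilon> d \<rho> \<sigma> (1/2) (1/10)" .
qed

end
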